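(* Let $n\ge4$ and consider $M=G/H=SO(n)/(SO(2)\times SO(n-3))$ as a $6$-symmetric space generated by $\Phi(A)=BAB^{-1}$ with $B=\operatorname{diag}\left\{1,\begin{pmatrix}\frac12&\frac{\sqrt3}{2}\\-\frac{\sqrt3}{2}&\frac12\end{pmatrix},-1,\dots,-1\right\}$ ($n-3$ entries equal to $-1$). Let $(s,t)$ be the characteristic numbers of an invariant Riemannian metric on $M$, and let $$f_1=\tfrac{1}{\sqrt3}(\theta-\theta^5),\quad f_2=\tfrac{1}{2\sqrt3}(\theta-\theta^2+\theta^4-\theta^5),\quad f_3=\tfrac{1}{2\sqrt3}(\theta+\theta^2-\theta^4-\theta^5),\quad f_4=\tfrac1{\sqrt3}(\theta^2-\theta^4)$$ be the canonical $f$-structures. Then, with respect to this metric: 1) $f_1$ is a Killing $f$-structure if and only if $s=1$, $t=\frac43$; $f_2,f_3,f_4$ are not Killing $f$-structures for any $s$ and $t$. 2) $f_1$ is an $NKf$-structure if and only if $s=1$; $f_2$ and $f_3$ are $NKf$-structures for any $s$ and $t$; $f_4$ is not an $NKf$-structure for any $s$ and $t$. 3) $f_1,f_2,f_3,f_4$ are $G_1f$-structures for any $s$ and $t$.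
   Context: Here $G=SO(n)$ and $H=SO(2)\times SO(n-3)$ is embedded block-diagonally as $\operatorname{diag}\{1,A_1,A_2\}$, $A_1\in SO(2)$, $A_2\in SO(n-3)$; $\mathfrak g=\mathfrak{so}(n)$, $\mathfrak h$ is the Lie algebra of $H$. The canonical reductive complement is $\mathfrak m=(\varphi-\mathrm{id})\mathfrak g$, where $\varphi=d\Phi_e$ (so $\varphi(X)=BXB^{-1}$); $\mathfrak g=\mathfrak h\oplus\mathfrak m$, and $\mathfrak m$ is identified with the tangent space at $o=H$. Put $\theta=\varphi|_{\mathfrak m}$. Explicitly, $\mathfrak m=\mathfrak m_1\oplus\mathfrak m_2\oplus\mathfrak m_3$, where, within skew-symmetric matrices $S=(s_{ij})$, - $\mathfrak m_1$: only $s_{12},s_{13}$ (and $s_{21}=-s_{12}$, $s_{31}=-s_{13}$) may be nonzero; - $\mathfrak m_2$: only $s_{2j},s_{3j}$, $4\le j\le n$ (and their negatives $s_{j2},s_{j3}$) may be nonzero; - $\mathfrak m_3$: only $s_{1j}$, $4\le j\le n$ (and $s_{j1}=-s_{1j}$) may be nonzero. An invariant $(1,1)$-tensor field on $G/H$ is identified with its value at $o$, an $\mathrm{Ad}(H)$-invariant endomorphism of $\mathfrak m$; it is canonical if it is a polynomial in $\theta$. An $f$-structure is a $(1,1)$-tensor field $f$ with $f^3+f=0$. Explicitly, let $J_1$ be the endomorphism of $\mathfrak m$ vanishing on $\mathfrak m_2\oplus\mathfrak m_3$ and acting on $\mathfrak m_1$ by $(s_{12},s_{13})\mapsto(s_{13},-s_{12})$,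 and let $J_2$ be the endomorphism vanishing on $\mathfrak m_1\oplus\mathfrak m_3$ and acting on $\mathfrak m_2$ by $(s_{2j},s_{3j})\mapsto(-s_{3j},s_{2j})$, $4\le j\le n$. Then $f_1=J_1+J_2$, $f_2=J_2$, $f_3=J_1$, $f_4=J_1-J_2$. Let $g_0=-K|_{\mathfrak m\times\mathfrak m}$, where $K$ is the Killing form of $\mathfrak{so}(n)$. Invariant Riemannian metrics are considered up to a positive coefficient, and are the metrics $$g=g_0|_{\mathfrak m_1}+s\,g_0|_{\mathfrak m_2}+t\,g_0|_{\mathfrak m_3},\qquad s,t>0$$ (with $\mathfrak m_1,\mathfrak m_2,\mathfrak m_3$ mutually orthogonal); $(s,t)$ are called the characteristic numbers of $g$. Let $\nabla$ be the Levi-Civita connection of $g$. A metric $f$-structure is an $f$-structure with $g(fX,Y)+g(X,fY)=0$ for all vector fields $X,Y$. A metric $f$-structure $f$ is - a Killing $f$-structure if $\nabla_X(f)X=0$ for all vector fields $X$; - a nearly Kähler $f$-structure ($NKf$-structure) if $\nabla_{fX}(f)fX=0$ for all vector fields $X$; - a $G_1f$-structure if $T(X,X)=0$ for all vector fields $X$, where $T(X,Y)=\frac14 f\big(\nabla_{fX}(f)fY-\nabla_{f^2X}(f)f^2Y\big)$. *)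

theory Defs
  imports "HOL-Analysis.Analysis"
begin

section \<open>Labelled matrices\<close>

text \<open>Real \<open>n \<times> n\<close> matrices are indexed by a finite type \<open>'n\<close> with \<open>n = CARD('n)\<close>; \<open>ix\<close> is a fixed
  bijection from the labels \<open>{1..n}\<close> onto this type, and \<open>entry S i j\<close> is \<open>s\<^sub>i\<^sub>j\<close> for \<open>1 \<le> i, j \<le> n\<close>.\<close>

type_synonym 'n mat = "real^'n^'n"

definition ix :: "nat \<Rightarrow> 'n::finite" where
  "ix i = from_nat_into UNIV (i - 1)"

lemma bij_betw_ix: "bij_betw (ix :: nat \<Rightarrow> 'n::finite) {1..CARD('n)} UNIV"
proof -
  have "bij_betw (\<lambda>i. i - 1) {1..CARD('n)} {..<CARD('n)}"
    by (rule bij_betw_byWitness[where f' = Suc]) auto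
  from bij_betw_trans[OF this bij_betw_from_nat_into_finite[OF finite_class.finite_UNIV]]
  show ?thesis by (simp add: ix_def[abs_def] comp_def)
qed

definition entry :: "'n::finite mat \<Rightarrow> nat \<Rightarrow> nat \<Rightarrow> real" where
  "entry S i j = S $ ix i $ ix j"

section \<open>The groups and the Lie algebra\<close>

definition SO :: "('n::finite mat) set" where
  "SO = {A. orthogonal_matrix A \<and> det A = 1}"

definition so :: "('n::finite mat) set" where
  "so = {S. transpose S = - S}"

definition lie_bracket :: "'n::finite mat \<Rightarrow> 'n mat \<Rightarrow> 'n mat" where
  "lie_bracket X Y = X ** Y - Y ** X"

text \<open>The copy of \<open>SO(k)\<close>, \<open>k = card I\<close>, acting on the coordinates in \<open>I\<close> and trivially on the others.\<close>

definition SO_on :: "'n::finite set \<Rightarrow> ('n mat) set" where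
  "SO_on I = {A \<in> SO. \<forall>a b. a \<notin> I \<or> b \<notin> I \<longrightarrow> A $ a $ b = (if a = b then 1 else 0)}"

text \<open>\<open>diag{1, A\<^sub>1, A\<^sub>2} = diag{1, A\<^sub>1, E} diag{1, E, A\<^sub>2}\<close> with \<open>A\<^sub>1 \<in> SO(2)\<close> and \<open>A\<^sub>2 \<in> SO(n - 3)\<close>.\<close>

definition H :: "('n::finite mat) set" where
  "H = {A\<^sub>1 ** A\<^sub>2 | A\<^sub>1 A\<^sub>2. A\<^sub>1 \<in> SO_on (ix ` {2, 3}) \<and> A\<^sub>2 \<in> SO_on (ix ` {4..CARD('n)})}"

section \<open>The automorphism of order 6 and the canonical reductive complement\<close>

definition B :: "'n::finite mat" where
  "B = (\<chi> a b.
     if a = ix 1 \<and> b = ix 1 then 1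
     else if a = ix 2 \<and> b = ix 2 \<or> a = ix 3 \<and> b = ix 3 then 1 / 2
     else if a = ix 2 \<and> b = ix 3 then sqrt 3 / 2
     else if a = ix 3 \<and> b = ix 2 then - (sqrt 3 / 2)
     else if a = b then - 1 else 0)"

text \<open>Conjugation \<open>A \<mapsto> B A B\<^sup>-\<^sup>1\<close> is linear in \<open>A\<close>, so the same formula gives the automorphism \<open>\<Phi>\<close> of \<open>SO(n)\<close>
  and its differential \<open>\<phi>\<close> on \<open>so(n)\<close>. On \<open>\<mm>\<close> it is \<open>\<theta>\<close>.\<close>

definition phi :: "'n::finite mat \<Rightarrow> 'n mat" where
  "phi X = B ** X ** matrix_inv B"

definition \<mm> :: "('n::finite mat) set" where
  "\<mm> = (\<lambda>X. phi X - X) ` so"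

text \<open>Endomorphisms of \<open>\<mm>\<close> are given as functions on all matrices; only their values on \<open>\<mm>\<close> matter.\<close>

definition canon_f1 :: "'n::finite mat \<Rightarrow> 'n mat" where
  "canon_f1 X = (1 / sqrt 3) *\<^sub>R (phi X - (phi ^^ 5) X)"

definition canon_f2 :: "'n::finite mat \<Rightarrow> 'n mat" where
  "canon_f2 X = (1 / (2 * sqrt 3)) *\<^sub>R (phi X - (phi ^^ 2) X + (phi ^^ 4) X - (phi ^^ 5) X)"

definition canon_f3 :: "'n::finite mat \<Rightarrow> 'n mat" where
  "canon_f3 X = (1 / (2 * sqrt 3)) *\<^sub>R (phi X + (phi ^^ 2) X - (phi ^^ 4) X - (phi ^^ 5) X)"

definition canon_f4 :: "'n::finite mat \<Rightarrow> 'n mat" where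
  "canon_f4 X = (1 / sqrt 3) *\<^sub>R ((phi ^^ 2) X - (phi ^^ 4) X)"

section \<open>Invariant metrics\<close>

definition skew_unit :: "nat \<Rightarrow> nat \<Rightarrow> 'n::finite mat" where
  "skew_unit i j = (\<chi> a b. if a = ix i \<and> b = ix j then 1 else if a = ix j \<and> b = ix i then - 1 else 0)"

text \<open>The Killing form of \<open>so(n)\<close>, i.e. the trace of \<open>ad X \<circ> ad Y\<close>, in the basis \<open>skew_unit i j\<close>, \<open>i < j\<close>:
  the coefficient of \<open>S \<in> so(n)\<close> at \<open>skew_unit i j\<close> is \<open>s\<^sub>i\<^sub>j\<close>.\<close>

definition killing_form :: "'n::finite mat \<Rightarrow> 'n mat \<Rightarrow> real" where
  "killing_form X Y =
     (\<Sum>(i, j) \<in> {(i, j). 1 \<le> i \<and> i < j \<and> j \<le> CARD('n)}.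
        entry (lie_bracket X (lie_bracket Y (skew_unit i j))) i j)"

definition g0 :: "'n::finite mat \<Rightarrow> 'n mat \<Rightarrow> real" where
  "g0 X Y = - killing_form X Y"

text \<open>The components in \<open>\<mm>\<^sub>1\<close>, \<open>\<mm>\<^sub>2\<close>, \<open>\<mm>\<^sub>3\<close> of an element of \<open>\<mm>\<close>: keep the entries \<open>s\<^sub>i\<^sub>j\<close>, \<open>s\<^sub>j\<^sub>i\<close> with \<open>(i, j) \<in> I\<close>.\<close>

definition keep_entries :: "(nat \<times> nat) set \<Rightarrow> 'n::finite mat \<Rightarrow> 'n mat" where
  "keep_entries I S =
     (\<chi> a b. if \<exists>(i, j) \<in> I. a = ix i \<and> b = ix j \<or> a = ix j \<and> b = ix i then S $ a $ b else 0)"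

definition \<mm>1_part :: "'n::finite mat \<Rightarrow> 'n mat" where
  "\<mm>1_part = keep_entries ({1} \<times> {2, 3})"

definition \<mm>2_part :: "'n::finite mat \<Rightarrow> 'n mat" where
  "\<mm>2_part = keep_entries ({2, 3} \<times> {4..CARD('n)})"

definition \<mm>3_part :: "'n::finite mat \<Rightarrow> 'n mat" where
  "\<mm>3_part = keep_entries ({1} \<times> {4..CARD('n)})"

definition inv_metric :: "real \<Rightarrow> real \<Rightarrow> 'n::finite mat \<Rightarrow> 'n mat \<Rightarrow> real" where
  "inv_metric s t X Y =
     g0 (\<mm>1_part X) (\<mm>1_part Y) + s * g0 (\<mm>2_part X) (\<mm>2_part Y) + t * g0 (\<mm>3_part X) (\<mm>3_part Y)"

section \<open>Smooth functions and vector fields on the homogeneous space\<close>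

primrec Ck_on :: "nat \<Rightarrow> ('a::euclidean_space \<Rightarrow> 'b::real_normed_vector) \<Rightarrow> 'a set \<Rightarrow> bool" where
  "Ck_on 0 F U \<longleftrightarrow> continuous_on U F"
| "Ck_on (Suc k) F U \<longleftrightarrow>
     (\<exists>F'. (\<forall>x\<in>U. (F has_derivative F' x) (at x)) \<and> (\<forall>v. Ck_on k (\<lambda>x. F' x v) U))"

text \<open>Smoothness on a submanifold of a Euclidean space: local existence of smooth extensions.\<close>

definition smooth_on :: "'a::euclidean_space set \<Rightarrow> ('a \<Rightarrow> 'b::real_normed_vector) \<Rightarrow> bool" where
  "smooth_on S F \<longleftrightarrow>
     (\<forall>x\<in>S. \<exists>U G. open U \<and> x \<in> U \<and> (\<forall>k. Ck_on k G U) \<and> (\<forall>y\<in>U \<inter> S. G y = F y))"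

text \<open>Functions on \<open>M = SO(n)/H\<close> are functions on \<open>SO(n)\<close> that are constant on the cosets \<open>A H\<close>. Values
  outside \<open>SO(n)\<close> are irrelevant here and below.\<close>

definition smooth_function :: "('n::finite mat \<Rightarrow> real) \<Rightarrow> bool" where
  "smooth_function u \<longleftrightarrow> smooth_on SO u \<and> (\<forall>A\<in>SO. \<forall>h\<in>H. u (A ** h) = u A)"

text \<open>The tangent space of \<open>M\<close> at \<open>A H\<close> is identified with \<open>\<mm>\<close> by the translation by \<open>A\<close>: \<open>\<xi> \<in> \<mm>\<close> stands for the
  velocity at \<open>0\<close> of \<open>A exp(\<tau>\<xi>) H\<close>. Replacing the representative \<open>A\<close> by \<open>A h\<close> replaces \<open>\<xi>\<close> by \<open>Ad(h\<^sup>-\<^sup>1) \<xi>\<close>. Thus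
  vector fields on \<open>M\<close> are the smooth equivariant maps \<open>SO(n) \<rightarrow> \<mm>\<close> (\<open>TM = SO(n) \<times>\<^sub>H \<mm>\<close>). An invariant
  tensor field acts in this picture by applying its value at \<open>o\<close> pointwise.\<close>

definition vector_field :: "('n::finite mat \<Rightarrow> 'n mat) \<Rightarrow> bool" where
  "vector_field X \<longleftrightarrow> smooth_on SO X \<and> (\<forall>A\<in>SO. X A \<in> \<mm>) \<and>
     (\<forall>A\<in>SO. \<forall>h\<in>H. X (A ** h) = matrix_inv h ** X A ** h)"

text \<open>The derivative of a function along a vector field. \<open>A ** X A\<close> is tangent to \<open>SO(n)\<close> at \<open>A\<close>, so it does not
  matter which derivative of \<open>u\<close> within \<open>SO(n)\<close> is chosen.\<close>

definition deriv_along :: "('n::finite mat \<Rightarrow> 'n mat) \<Rightarrow> ('n mat \<Rightarrow> real) \<Rightarrow> 'n mat \<Rightarrow> real" where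
  "deriv_along X u A = frechet_derivative u (at A within SO) (A ** X A)"

definition is_vf_bracket ::
    "('n::finite mat \<Rightarrow> 'n mat) \<Rightarrow> ('n mat \<Rightarrow> 'n mat) \<Rightarrow> ('n mat \<Rightarrow> 'n mat) \<Rightarrow> bool" where
  "is_vf_bracket X Y Z \<longleftrightarrow> vector_field Z \<and>
     (\<forall>u. smooth_function u \<longrightarrow> (\<forall>A\<in>SO.
        deriv_along Z u A = deriv_along X (deriv_along Y u) A - deriv_along Y (deriv_along X u) A))"

section \<open>The Levi-Civita connection\<close>

type_synonym 'n connection = "('n mat \<Rightarrow> 'n mat) \<Rightarrow> ('n mat \<Rightarrow> 'n mat) \<Rightarrow> ('n mat \<Rightarrow> 'n mat)"

definition affine_connection :: "'n::finite connection \<Rightarrow> bool" where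
  "affine_connection nabla \<longleftrightarrow>
     (\<forall>X Y. vector_field X \<and> vector_field Y \<longrightarrow> vector_field (nabla X Y)) \<and>
     (\<forall>X Y Z. vector_field X \<and> vector_field Y \<and> vector_field Z \<longrightarrow>
        (\<forall>A\<in>SO. nabla (\<lambda>A. X A + Y A) Z A = nabla X Z A + nabla Y Z A) \<and>
        (\<forall>A\<in>SO. nabla X (\<lambda>A. Y A + Z A) A = nabla X Y A + nabla X Z A)) \<and>
     (\<forall>u X Y. smooth_function u \<and> vector_field X \<and> vector_field Y \<longrightarrow>
        (\<forall>A\<in>SO. nabla (\<lambda>A. u A *\<^sub>R X A) Y A = u A *\<^sub>R nabla X Y A) \<and>
        (\<forall>A\<in>SO. nabla X (\<lambda>A. u A *\<^sub>R Y A) A = u A *\<^sub>R nabla X Y A + deriv_along X u A *\<^sub>R Y A))"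

definition levi_civita ::
    "('n::finite mat \<Rightarrow> 'n mat \<Rightarrow> real) \<Rightarrow> 'n connection \<Rightarrow> bool" where
  "levi_civita g nabla \<longleftrightarrow> affine_connection nabla \<and>
     (\<forall>X Y. vector_field X \<and> vector_field Y \<longrightarrow> is_vf_bracket X Y (\<lambda>A. nabla X Y A - nabla Y X A)) \<and>
     (\<forall>X Y Z. vector_field X \<and> vector_field Y \<and> vector_field Z \<longrightarrow>
        (\<forall>A\<in>SO. deriv_along X (\<lambda>A. g (Y A) (Z A)) A = g (nabla X Y A) (Z A) + g (Y A) (nabla X Z A)))"

section \<open>Invariant metric f-structures\<close>

definition f_structure :: "('n::finite mat \<Rightarrow> 'n mat) \<Rightarrow> bool" where
  "f_structure f \<longleftrightarrow>
     (\<forall>x\<in>\<mm>. f x \<in> \<mm>) \<and>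
     (\<forall>x\<in>\<mm>. \<forall>y\<in>\<mm>. f (x + y) = f x + f y) \<and> (\<forall>c. \<forall>x\<in>\<mm>. f (c *\<^sub>R x) = c *\<^sub>R f x) \<and>
     (\<forall>h\<in>H. \<forall>x\<in>\<mm>. f (h ** x ** matrix_inv h) = h ** f x ** matrix_inv h) \<and>
     (\<forall>x\<in>\<mm>. f (f (f x)) + f x = 0)"

definition metric_f_structure ::
    "('n::finite mat \<Rightarrow> 'n mat \<Rightarrow> real) \<Rightarrow> ('n mat \<Rightarrow> 'n mat) \<Rightarrow> bool" where
  "metric_f_structure g f \<longleftrightarrow> f_structure f \<and>
     (\<forall>X Y. vector_field X \<and> vector_field Y \<longrightarrow>
        (\<forall>A\<in>SO. g (f (X A)) (Y A) + g (X A) (f (Y A)) = 0))"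

text \<open>\<open>nabla_f nabla f X Y\<close> is \<open>(nabla\<^sub>X f) Y\<close>.\<close>

definition nabla_f ::
    "'n::finite connection \<Rightarrow> ('n mat \<Rightarrow> 'n mat) \<Rightarrow>
     ('n mat \<Rightarrow> 'n mat) \<Rightarrow> ('n mat \<Rightarrow> 'n mat) \<Rightarrow> ('n mat \<Rightarrow> 'n mat)" where
  "nabla_f nabla f X Y = (\<lambda>A. nabla X (f \<circ> Y) A - f (nabla X Y A))"

definition killing_f_structure ::
    "('n::finite mat \<Rightarrow> 'n mat \<Rightarrow> real) \<Rightarrow> 'n connection \<Rightarrow> ('n mat \<Rightarrow> 'n mat) \<Rightarrow> bool" where
  "killing_f_structure g nabla f \<longleftrightarrow> metric_f_structure g f \<and>
     (\<forall>X. vector_field X \<longrightarrow> (\<forall>A\<in>SO. nabla_f nabla f X X A = 0))"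

definition NKf_structure ::
    "('n::finite mat \<Rightarrow> 'n mat \<Rightarrow> real) \<Rightarrow> 'n connection \<Rightarrow> ('n mat \<Rightarrow> 'n mat) \<Rightarrow> bool" where
  "NKf_structure g nabla f \<longleftrightarrow> metric_f_structure g f \<and>
     (\<forall>X. vector_field X \<longrightarrow> (\<forall>A\<in>SO. nabla_f nabla f (f \<circ> X) (f \<circ> X) A = 0))"

definition tensor_T ::
    "'n::finite connection \<Rightarrow> ('n mat \<Rightarrow> 'n mat) \<Rightarrow>
     ('n mat \<Rightarrow> 'n mat) \<Rightarrow> ('n mat \<Rightarrow> 'n mat) \<Rightarrow> ('n mat \<Rightarrow> 'n mat)" where
  "tensor_T nabla f X Y = (\<lambda>A. (1 / 4) *\<^sub>R
     f (nabla_f nabla f (f \<circ> X) (f \<circ> Y) A - nabla_f nabla f (f \<circ> f \<circ> X) (f \<circ> f \<circ> Y) A))"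

definition G1f_structure ::
    "('n::finite mat \<Rightarrow> 'n mat \<Rightarrow> real) \<Rightarrow> 'n connection \<Rightarrow> ('n mat \<Rightarrow> 'n mat) \<Rightarrow> bool" where
  "G1f_structure g nabla f \<longleftrightarrow> metric_f_structure g f \<and>
     (\<forall>X. vector_field X \<longrightarrow> (\<forall>A\<in>SO. tensor_T nabla f X X A = 0))"

end

theory Submission
  imports Defs
begin

text \<open>Lifted to \<open>SO(n)\<close>, the Levi-Civita connection is \<open>\<nabla>\<^sub>X Y = X(Y) + \<Lambda>(X, Y)\<close> for a bilinear map
  \<open>\<Lambda>\<close> on \<open>\<mm>\<close>. With \<open>Q = diag(1, s, t)\<close> on \<open>\<mm>\<^sub>1 \<oplus> \<mm>\<^sub>2 \<oplus> \<mm>\<^sub>3\<close> the metric is a multiple of \<open>x \<bullet> Q y\<close>, and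
  Koszul's formula reads \<open>2 Q \<Lambda>(x, y) = (Q[x, y] + [x, Q y] - [Q x, y])\<^sub>\<mm>\<close>. The functions needed to read
  off the torsion are the entries of \<open>A B A\<^sup>T\<close>, whose differentials separate \<open>\<mm>\<close> because \<open>\<hh>\<close> is the
  centralizer of \<open>B\<close> in \<open>so(n)\<close>; vector fields with a prescribed value are the projections of
  \<open>A\<^sup>T W A\<close> to \<open>\<mm>\<close>. Since a canonical \<open>f\<close> is constant in this picture,
  \<open>(\<nabla>\<^sub>X f) X = \<Lambda>(x, f x) - f \<Lambda>(x, x)\<close>, and for \<open>f = e\<^sub>1 J\<^sub>1 + e\<^sub>2 J\<^sub>2\<close> its three components are fixed
  quadratic expressions in \<open>x\<close> times coefficients depending on \<open>s, t, e\<^sub>1, e\<^sub>2\<close> only.\<close>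

section \<open>Smooth maps\<close>

lemma Ck_on_Suc_imp: "Ck_on (Suc k) F U \<Longrightarrow> Ck_on k F U"
proof (induction k arbitrary: F)
  case 0
  then show ?case
    by (auto intro!: continuous_at_imp_continuous_on dest!: has_derivative_continuous)
next
  case (Suc k)
  then obtain F' where "\<forall>x\<in>U. (F has_derivative F' x) (at x)" "\<And>v. Ck_on (Suc k) (\<lambda>x. F' x v) U"
    by (metis Ck_on.simps(2))
  with Suc.IH show ?case
    unfolding Ck_on.simps(2)[of k] by blast
qed

lemma Ck_on_const: "Ck_on k (\<lambda>x. c) U"
proof (induction k arbitrary: c)
  case (Suc k)
  then show ?case by (auto intro!: exI[of _ "\<lambda>x v. 0"])
qed simp

lemma Ck_on_ident: "Ck_on k (\<lambda>x. x) U"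
proof (cases k)
  case (Suc k)
  then show ?thesis by (auto intro!: exI[of _ "\<lambda>x v. v"] Ck_on_const)
qed simp

lemma Ck_on_add: "Ck_on k F U \<Longrightarrow> Ck_on k G U \<Longrightarrow> Ck_on k (\<lambda>x. F x + G x) U"
proof (induction k arbitrary: F G)
  case 0
  then show ?case by (auto intro: continuous_on_add)
next
  case (Suc k)
  obtain F' where F: "\<forall>x\<in>U. (F has_derivative F' x) (at x)" "\<And>v. Ck_on k (\<lambda>x. F' x v) U"
    using Suc.prems(1) by auto
  obtain G' where G: "\<forall>x\<in>U. (G has_derivative G' x) (at x)" "\<And>v. Ck_on k (\<lambda>x. G' x v) U"
    using Suc.prems(2) by auto
  show ?case
    unfolding Ck_on.simps(2)
    by (rule exI[of _ "\<lambda>x v. F' x v + G' x v"]) (use F G Suc.IH in \<open>auto intro: has_derivative_add\<close>)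
qed

lemma Ck_on_bounded_linear:
  assumes "bounded_linear L"
  shows "Ck_on k F U \<Longrightarrow> Ck_on k (\<lambda>x. L (F x)) U"
proof (induction k arbitrary: F)
  case 0
  then show ?case using assms by (auto intro: bounded_linear.continuous_on)
next
  case (Suc k)
  obtain F' where F: "\<forall>x\<in>U. (F has_derivative F' x) (at x)" "\<And>v. Ck_on k (\<lambda>x. F' x v) U"
    using Suc.prems(1) by auto
  show ?case
    unfolding Ck_on.simps(2)
    by (rule exI[of _ "\<lambda>x v. L (F' x v)"])
      (use F Suc.IH in \<open>auto intro: bounded_linear.has_derivative[OF assms]\<close>)
qed

lemma Ck_on_bounded_bilinear:
  assumes "bounded_bilinear P"
  shows "Ck_on k F U \<Longrightarrow> Ck_on k G U \<Longrightarrow> Ck_on k (\<lambda>x. P (F x) (G x)) U"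
proof (induction k arbitrary: F G)
  case 0
  then show ?case using assms by (auto intro: bounded_bilinear.continuous_on)
next
  case (Suc k)
  obtain F' where F: "\<forall>x\<in>U. (F has_derivative F' x) (at x)" "\<And>v. Ck_on k (\<lambda>x. F' x v) U"
    using Suc.prems(1) by auto
  obtain G' where G: "\<forall>x\<in>U. (G has_derivative G' x) (at x)" "\<And>v. Ck_on k (\<lambda>x. G' x v) U"
    using Suc.prems(2) by auto
  show ?case
    unfolding Ck_on.simps(2)
  proof (rule exI[of _ "\<lambda>x v. P (F x) (G' x v) + P (F' x v) (G x)"], intro conjI allI ballI)
    show "((\<lambda>x. P (F x) (G x)) has_derivative (\<lambda>v. P (F x) (G' x v) + P (F' x v) (G x))) (at x)"
      if "x \<in> U" for x
      using F G that by (auto intro: bounded_bilinear.FDERIV[OF assms])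
    show "Ck_on k (\<lambda>x. P (F x) (G' x v) + P (F' x v) (G x)) U" for v
      \<comment> \<open>The product rule pairs each derivative with an undifferentiated factor, so
        \<open>F\<close> and \<open>G\<close> themselves enter the induction hypothesis at order
        \<open>k\<close> instead of \<open>Suc k\<close>.\<close>
      using Suc.IH F(2) G(2) Ck_on_Suc_imp[OF Suc.prems(1)] Ck_on_Suc_imp[OF Suc.prems(2)]
      by (intro Ck_on_add) auto
  qed
qed

lemma smooth_on_global: "(\<And>k. Ck_on k F UNIV) \<Longrightarrow> smooth_on S F"
  unfolding smooth_on_def by (intro ballI exI[of _ UNIV] exI[of _ F]) auto

lemma smooth_on_bounded_linear:
  assumes "bounded_linear L" and "smooth_on S F"
  shows "smooth_on S (L \<circ> F)"
  unfolding smooth_on_def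
proof
  fix x assume "x \<in> S"
  then obtain U G where "open U" "x \<in> U" "\<forall>k. Ck_on k G U" "\<forall>y\<in>U \<inter> S. G y = F y"
    using assms(2) unfolding smooth_on_def by blast
  then show "\<exists>U G. open U \<and> x \<in> U \<and> (\<forall>k. Ck_on k G U) \<and> (\<forall>y\<in>U \<inter> S. G y = (L \<circ> F) y)"
    by (intro exI[of _ U] exI[of _ "\<lambda>x. L (G x)"]) (auto intro: Ck_on_bounded_linear assms(1))
qed

text \<open>Near \<open>x\<close> the smooth extension agrees with \<open>F\<close> on
  \<open>S\<close>, so its derivative is also a derivative of \<open>F\<close> within
  \<open>S\<close>.\<close>

lemma smooth_on_imp_differentiable:
  assumes "smooth_on S F" and "x \<in> S"
  shows "F differentiable (at x within S)"
proof -
  obtain U G where U: "open U" "x \<in> U" "\<forall>k. Ck_on k G U" "\<forall>y\<in>U \<inter> S. G y = F y"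
    using assms unfolding smooth_on_def by blast
  have "Ck_on (Suc 0) G U" using U(3) by blast
  then obtain G' where "(G has_derivative G') (at x)" using U(2) by auto
  then have "(G has_derivative G') (at x within S)"
    by (rule has_derivative_at_withinI)
  moreover obtain e where "e > 0" "ball x e \<subseteq> U"
    using U(1,2) openE by blast
  ultimately have "(F has_derivative G') (at x within S)"
    using U(4) assms(2)
    by (auto elim!: has_derivative_transform_within[where d=e] simp: subset_iff dist_commute)
  then show ?thesis by (auto simp: differentiable_def)
qed

section \<open>Matrices\<close>

lemma matrix_add_rdistrib: "(A + D) ** C = A ** C + D ** C" for A :: "real^'n^'m"
  by (simp add: vec_eq_iff matrix_matrix_mult_def algebra_simps sum.distrib)

lemma matrix_diff_ldistrib: "A ** (C - D) = A ** C - A ** D" for A :: "real^'n^'m"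
  by (simp add: vec_eq_iff matrix_matrix_mult_def algebra_simps sum_subtractf)

lemma matrix_diff_rdistrib: "(A - D) ** C = A ** C - D ** C" for A :: "real^'n^'m"
  by (simp add: vec_eq_iff matrix_matrix_mult_def algebra_simps sum_subtractf)

lemma matrix_minus_left: "(- A) ** C = - (A ** C)" for A :: "real^'n^'m"
  by (simp add: vec_eq_iff matrix_matrix_mult_def sum_negf)

lemma matrix_minus_right: "A ** (- C) = - (A ** C)" for A :: "real^'n^'m"
  by (simp add: vec_eq_iff matrix_matrix_mult_def sum_negf)

lemma matrix_scaleR_left: "(r *\<^sub>R A) ** C = r *\<^sub>R (A ** C)" for A :: "real^'n^'m"
  by (simp add: vec_eq_iff matrix_matrix_mult_def sum_distrib_left mult.assoc)

lemma matrix_scaleR_right: "A ** (r *\<^sub>R C) = r *\<^sub>R (A ** C)" for A :: "real^'n^'m"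
  by (simp add: vec_eq_iff matrix_matrix_mult_def sum_distrib_left algebra_simps)

lemmas matrix_distribs =
  matrix_add_ldistrib matrix_add_rdistrib matrix_diff_ldistrib matrix_diff_rdistrib
  matrix_minus_left matrix_minus_right matrix_scaleR_left matrix_scaleR_right

lemma bounded_bilinear_matrix_mult:
  "bounded_bilinear ((**) :: real^'n^'m \<Rightarrow> real^'k^'n \<Rightarrow> real^'k^'m)"
  by (simp flip: bilinear_conv_bounded_bilinear add: bilinear_def linear_iff matrix_distribs)

lemma transpose_add: "transpose (A + C) = transpose A + transpose C"
  and transpose_diff: "transpose (A - C) = transpose A - transpose C"
  and transpose_scaleR: "transpose (r *\<^sub>R A) = r *\<^sub>R transpose A" for A :: "real^'n^'m"
  by (simp_all add: transpose_def vec_eq_iff)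

lemma bounded_linear_transpose: "bounded_linear (transpose :: real^'n^'m \<Rightarrow> real^'m^'n)"
  by (simp flip: linear_conv_bounded_linear add: linear_iff transpose_add transpose_scaleR)

lemma so_component: "x \<in> so \<Longrightarrow> x $ q $ p = - (x $ p $ q)"
proof -
  assume "x \<in> so"
  then have "transpose x $ p $ q = (- x) $ p $ q" by (simp add: so_def)
  then show ?thesis by (simp add: transpose_def)
qed

lemma so_diagonal: "x \<in> so \<Longrightarrow> x $ p $ p = 0"
  using so_component[of x p p] by simp

lemma soI: "(\<And>p q. x $ q $ p = - (x $ p $ q)) \<Longrightarrow> x \<in> so"
  unfolding so_def transpose_def by (auto simp only: vec_eq_iff vec_lambda_beta vector_uminus_component)

lemma subspace_so: "subspace so"
  by (auto simp: subspace_def so_def transpose_add transpose_scaleR)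
    (simp add: transpose_def vec_eq_iff)

lemma lie_bracket_so: "x \<in> so \<Longrightarrow> y \<in> so \<Longrightarrow> lie_bracket x y \<in> so"
  by (simp add: so_def lie_bracket_def transpose_diff matrix_transpose_mul matrix_distribs)

lemma SO_cancel:
  assumes "A \<in> SO"
  shows "transpose A ** A = mat 1" "A ** transpose A = mat 1"
    "transpose A ** (A ** C) = C" "A ** (transpose A ** C) = C"
  using assms by (simp_all add: SO_def orthogonal_matrix_def matrix_mul_assoc)

lemma matrix_inv_orthogonal:
  assumes "orthogonal_matrix A" shows "matrix_inv A = transpose A"
proof -
  have A: "A ** transpose A = mat 1" "transpose A ** A = mat 1"
    using assms by (simp_all add: orthogonal_matrix_def)
  then have "matrix_inv A ** A = mat 1"
    unfolding matrix_inv_def by (metis (mono_tags, lifting) someI)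
  with A(1) show ?thesis
    by (metis matrix_mul_assoc matrix_mul_lid matrix_mul_rid)
qed

lemma matrix_inv_SO: "A \<in> SO \<Longrightarrow> matrix_inv A = transpose A"
  by (simp add: SO_def matrix_inv_orthogonal)

lemma SO_mult: "A \<in> SO \<Longrightarrow> C \<in> SO \<Longrightarrow> A ** C \<in> SO"
  by (simp add: SO_def orthogonal_matrix_mul det_mul)

lemma so_conj: "x \<in> so \<Longrightarrow> C ** x ** transpose C \<in> so"
  by (simp add: so_def matrix_transpose_mul matrix_mul_assoc matrix_distribs)

lemma has_derivative_matrix_mult:
  fixes F :: "'a::real_normed_vector \<Rightarrow> real^'n^'m" and G :: "'a \<Rightarrow> real^'k^'n"
  assumes "(F has_derivative F') (at x within S)" "(G has_derivative G') (at x within S)"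
  shows "((\<lambda>x. F x ** G x) has_derivative (\<lambda>v. F x ** G' v + F' v ** G x)) (at x within S)"
  using assms by (rule bounded_bilinear.FDERIV[OF bounded_bilinear_matrix_mult])

lemma linear_has_derivative:
  fixes L :: "'a::euclidean_space \<Rightarrow> 'b::real_normed_vector"
  assumes "linear L" "(F has_derivative F') (at x within S)"
  shows "((\<lambda>x. L (F x)) has_derivative (\<lambda>v. L (F' v))) (at x within S)"
  using assms bounded_linear.has_derivative linear_conv_bounded_linear by blast

lemma lie_bracket_jacobi:
  "lie_bracket x (lie_bracket y z) - lie_bracket y (lie_bracket x z) = lie_bracket (lie_bracket x y) z"
  by (simp add: lie_bracket_def matrix_distribs matrix_mul_assoc)

lemma lie_bracket_diff_left: "lie_bracket (x - y) z = lie_bracket x z - lie_bracket y z"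
  by (simp add: lie_bracket_def matrix_distribs)

section \<open>Rotations and tangent vectors of \<open>SO(n)\<close>\<close>

text \<open>This is \<open>exp(\<tau>E)\<close> whenever \<open>E\<^sup>3 = - E\<close>.\<close>

definition rotation :: "'n::finite mat \<Rightarrow> real \<Rightarrow> 'n mat" where
  "rotation E \<tau> = mat 1 + sin \<tau> *\<^sub>R E + (1 - cos \<tau>) *\<^sub>R (E ** E)"

text \<open>Since the cube of \<open>E\<close> is \<open>- E\<close>, every product of powers of
  \<open>E\<close> reduces to a combination of \<open>mat 1\<close>, \<open>E\<close> and
  \<open>E ** E\<close>; the coefficients match by the addition formulas for sine and
  cosine.\<close>

lemma rotation_add:
  assumes "E ** E ** E = - E"
  shows "rotation E \<sigma> ** rotation E \<tau> = rotation E (\<sigma> + \<tau>)"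
proof -
  have "E ** (E ** E) = - E" "E ** E ** (E ** E) = - (E ** E)"
    using assms by (simp_all add: matrix_mul_assoc matrix_distribs)
  then have "rotation E \<sigma> ** rotation E \<tau> = mat 1 + (sin \<sigma> + sin \<tau> - sin \<sigma> * (1 - cos \<tau>) - (1 - cos \<sigma>) * sin \<tau>) *\<^sub>R E
     + ((1 - cos \<sigma>) + (1 - cos \<tau>) + sin \<sigma> * sin \<tau> - (1 - cos \<sigma>) * (1 - cos \<tau>)) *\<^sub>R (E ** E)"
    unfolding rotation_def using assms
    by (simp add: matrix_distribs algebra_simps)
  also have "\<dots> = rotation E (\<sigma> + \<tau>)"
    by (simp add: rotation_def sin_add cos_add algebra_simps)
  finally show ?thesis .
qed

lemma rotation_0 [simp]: "rotation E 0 = mat 1"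
  by (simp add: rotation_def)

lemma transpose_rotation: "E \<in> so \<Longrightarrow> transpose (rotation E \<tau>) = rotation E (- \<tau>)"
  by (simp add: rotation_def so_def transpose_add transpose_scaleR matrix_transpose_mul
      matrix_distribs transpose_mat)

text \<open>The determinant is \<open>1\<close> because a rotation is the square of the rotation by half the angle.\<close>

lemma rotation_in_SO:
  assumes "E \<in> so" and "E ** E ** E = - E"
  shows "rotation E \<tau> \<in> SO"
proof -
  have orth: "orthogonal_matrix (rotation E \<sigma>)" for \<sigma>
    using assms by (simp add: orthogonal_matrix_def transpose_rotation rotation_add)
  have "det (rotation E \<tau>) = det (rotation E (\<tau> / 2)) * det (rotation E (\<tau> / 2))"
    by (simp add: rotation_add[OF assms(2)] flip: det_mul)
  also have "\<dots> = 1"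
    using det_orthogonal_matrix[OF orth[of "\<tau> / 2"]] by auto
  finally show ?thesis using orth by (simp add: SO_def)
qed

lemma has_derivative_rotation_0: "(rotation E has_derivative (\<lambda>\<tau>. \<tau> *\<^sub>R E)) (at 0)"
  unfolding rotation_def[abs_def]
  by (auto intro!: derivative_eq_intros simp: fun_eq_iff)

section \<open>Elementary skew-symmetric matrices\<close>

definition skew :: "'n::finite \<Rightarrow> 'n \<Rightarrow> 'n mat" where
  "skew p q = (\<chi> i j. if i = p \<and> j = q then 1 else if i = q \<and> j = p then - 1 else 0)"

lemma skew_in_so: "p \<noteq> q \<Longrightarrow> skew p q \<in> so"
  by (rule soI) (auto simp: skew_def)

lemma skew_square:
  assumes "p \<noteq> q"
  shows "(skew p q ** skew p q) $ i $ j = (if i = j \<and> (i = p \<or> i = q) then - 1 else 0)"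
proof -
  have "skew p q $ i $ k * skew p q $ k $ j =
      (if k = q then if i = p \<and> j = p then - 1 else 0 else 0)
      + (if k = p then if i = q \<and> j = q then - 1 else 0 else 0)" for k
    using assms by (auto simp: skew_def)
  then show ?thesis
    using assms by (auto simp: matrix_matrix_mult_def sum.distrib)
qed

lemma skew_cube:
  assumes "p \<noteq> q"
  shows "skew p q ** skew p q ** skew p q = - skew p q"
proof -
  have "(skew p q ** skew p q) $ i $ k * skew p q $ k $ j =
     (if k = i then if i = p \<or> i = q then - skew p q $ i $ j else 0 else 0)" for i j k
    using assms by (auto simp: skew_square)
  then have "(skew p q ** skew p q ** skew p q) $ i $ j = (- skew p q) $ i $ j" for i j
    unfolding matrix_matrix_mult_def[of "skew p q ** skew p q"] by (simp add: skew_def)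
  then show ?thesis unfolding vec_eq_iff by blast
qed

text \<open>The factor 1/2 compensates for summing over ordered pairs: \<open>(p, q)\<close> and
  \<open>(q, p)\<close> contribute equally. For \<open>p = q\<close> the matrix
  \<open>skew p p\<close> is not skew-symmetric, but its coefficient is zero.\<close>

lemma so_skew_expansion:
  assumes "x \<in> so"
  shows "x = (\<Sum>p\<in>UNIV. \<Sum>q\<in>UNIV. (x $ p $ q / 2) *\<^sub>R skew p q)"
proof -
  have "(\<Sum>p\<in>UNIV. \<Sum>q\<in>UNIV. (x $ p $ q / 2) * skew p q $ i $ j) = x $ i $ j" for i j
  proof -
    have "(x $ p $ q / 2) * skew p q $ i $ j =
       (if q = j then if p = i then x $ i $ j / 2 else 0 else 0)
       + (if q = i then if p = j then x $ i $ j / 2 else 0 else 0)" for p q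
      using so_component[OF assms, of i j] so_diagonal[OF assms, of i] by (auto simp: skew_def)
    then show ?thesis by (simp only: sum.distrib) simp
  qed
  then show ?thesis by (simp add: vec_eq_iff)
qed

section \<open>Derivatives along tangent vectors of SO(n)\<close>

text \<open>The curves \<open>A ** rotation (skew p q) \<tau>\<close> stay in \<open>SO\<close> and
  have velocity \<open>A ** skew p q\<close> at 0. As \<open>F\<close> is constant along them,
  \<open>L\<close> vanishes on these velocities, and they span the tangent space at
  \<open>A\<close>.\<close>

lemma derivative_tangent_zero:
  fixes F :: "'n::finite mat \<Rightarrow> 'b::real_normed_vector"
  assumes F: "(F has_derivative L) (at A within SO)" and A: "A \<in> SO"
    and const: "\<And>C. C \<in> SO \<Longrightarrow> F C = c" and x: "x \<in> so"
  shows "L (A ** x) = 0"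
proof -
  have lin: "linear L" using F has_derivative_linear by blast
  have skew0: "L (A ** skew p q) = 0" if "p \<noteq> q" for p q
  proof -
    let ?\<gamma> = "\<lambda>\<tau>. A ** rotation (skew p q) \<tau>"
    have range: "?\<gamma> \<tau> \<in> SO" for \<tau>
      using A that by (auto intro!: SO_mult rotation_in_SO skew_in_so skew_cube)
    have "(?\<gamma> has_derivative (\<lambda>\<tau>. \<tau> *\<^sub>R (A ** skew p q))) (at 0)"
      using bounded_linear.has_derivative[OF bounded_bilinear.bounded_linear_right[OF
            bounded_bilinear_matrix_mult] has_derivative_rotation_0, of A "skew p q"]
      by (simp add: matrix_scaleR_right)
    \<comment> \<open>The chain rule asks for a derivative within the range of the curve, which is a
      subset of \<open>SO\<close>.\<close>
    moreover have "(F has_derivative L) (at (?\<gamma> 0) within range ?\<gamma>)"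
      using F range by (auto intro: has_derivative_subset)
    ultimately have "(F \<circ> ?\<gamma> has_derivative L \<circ> (\<lambda>\<tau>. \<tau> *\<^sub>R (A ** skew p q))) (at 0)"
      by (rule diff_chain_within)
    moreover have "F \<circ> ?\<gamma> = (\<lambda>\<tau>. c)" using range const by auto
    ultimately have "((\<lambda>\<tau>::real. c) has_derivative (\<lambda>\<tau>. L (\<tau> *\<^sub>R (A ** skew p q)))) (at 0)"
      by (simp add: comp_def)
    then have "(\<lambda>\<tau>. L (\<tau> *\<^sub>R (A ** skew p q))) = (\<lambda>\<tau>. 0)"
      using has_derivative_unique has_derivative_const by blast
    then have "L (1 *\<^sub>R (A ** skew p q)) = 0" by meson
    then show ?thesis by simp
  qed
  have term0: "(x $ p $ q / 2) *\<^sub>R L (A ** skew p q) = 0" for p q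
    using skew0[of p q] so_diagonal[OF x, of p] by (cases "p = q") auto
  have LA: "linear (\<lambda>y. L (A ** y))"
    using lin by (simp add: linear_iff matrix_distribs)
  have "L (A ** x) = (\<Sum>p\<in>UNIV. \<Sum>q\<in>UNIV. (x $ p $ q / 2) *\<^sub>R L (A ** skew p q))"
    by (subst so_skew_expansion[OF x]) (simp add: linear_sum[OF LA] linear_scale[OF LA])
  then show ?thesis by (simp add: term0)
qed

text \<open>\<open>SO\<close> has empty interior, so a derivative within it is not unique as a
  linear map on all matrices. Its values on tangent vectors are, because \<open>F - G\<close> is
  constant on \<open>SO\<close>.\<close>

lemma derivative_tangent_unique:
  fixes F G :: "'n::finite mat \<Rightarrow> 'b::real_normed_vector"
  assumes "(F has_derivative L) (at A within SO)" and "(G has_derivative K) (at A within SO)"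
    and "\<And>C. C \<in> SO \<Longrightarrow> F C = G C" and "A \<in> SO" and "x \<in> so"
  shows "L (A ** x) = K (A ** x)"
  using derivative_tangent_zero[OF has_derivative_diff[OF assms(1,2)] assms(4) _ assms(5), of 0] assms(3)
  by simp

text \<open>The chosen derivative inside \<open>deriv_along\<close> may be replaced by any
  derivative \<open>L\<close>, even one obtained from a formula \<open>u\<close> that agrees with
  \<open>v\<close> only on \<open>SO\<close>.\<close>

lemma deriv_along_eq:
  assumes u: "(u has_derivative L) (at A within SO)" and eq: "\<And>C. C \<in> SO \<Longrightarrow> v C = u C"
    and A: "A \<in> SO" and X: "X A \<in> so"
  shows "deriv_along X v A = L (A ** X A)"
proof -
  have "(v has_derivative L) (at A within SO)"
    using has_derivative_transform[OF A eq u] by simp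
  then have "(v has_derivative frechet_derivative v (at A within SO)) (at A within SO)"
    by (metis differentiable_def frechet_derivative_works)
  then show ?thesis
    unfolding deriv_along_def using derivative_tangent_unique[OF _ u eq A X] by blast
qed

text \<open>The derivative of the lift of \<open>Y\<close>, i.e. the covariant derivative of the canonical connection.\<close>

definition lift_deriv :: "('n::finite mat \<Rightarrow> 'n mat) \<Rightarrow> ('n mat \<Rightarrow> 'n mat) \<Rightarrow> 'n mat \<Rightarrow> 'n mat" where
  "lift_deriv X Y A = frechet_derivative Y (at A within SO) (A ** X A)"

section \<open>The automorphism and its eigenspaces\<close>

definition i1 :: "'n::finite" where "i1 = ix 1"
definition i2 :: "'n::finite" where "i2 = ix 2"
definition i3 :: "'n::finite" where "i3 = ix 3"
definition rest :: "'n::finite set" where "rest = - {i1, i2, i3}"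

text \<open>The bound on the dimension makes \<open>i1\<close>, \<open>i2\<close>, \<open>i3\<close>
  distinct and \<open>rest\<close> nonempty.\<close>

locale matrix_blocks =
  fixes type :: "'n::finite itself"
  assumes card4: "4 \<le> CARD('n)"
begin

lemma ix_eq_iff: "i \<in> {1..CARD('n)} \<Longrightarrow> j \<in> {1..CARD('n)} \<Longrightarrow> (ix i :: 'n) = ix j \<longleftrightarrow> i = j"
  using bij_betw_ix[where ?'n = 'n] by (auto simp: bij_betw_def inj_on_eq_iff)

lemma distinct_indices [simp]:
  "(i1 :: 'n) \<noteq> i2" "(i1 :: 'n) \<noteq> i3" "(i2 :: 'n) \<noteq> i3"
  "(i2 :: 'n) \<noteq> i1" "(i3 :: 'n) \<noteq> i1" "(i3 :: 'n) \<noteq> i2"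
  using card4 by (simp_all add: i1_def i2_def i3_def ix_eq_iff del: One_nat_def)

lemma rest_noteq [simp]:
  assumes "j \<in> (rest :: 'n set)"
  shows "j \<noteq> i1" "j \<noteq> i2" "j \<noteq> i3" "i1 \<noteq> j" "i2 \<noteq> j" "i3 \<noteq> j"
  using assms by (auto simp: rest_def)

lemma notin_rest [simp]: "(i1 :: 'n) \<notin> rest" "(i2 :: 'n) \<notin> rest" "(i3 :: 'n) \<notin> rest"
  by (simp_all add: rest_def)

lemma image_ix_rest: "ix ` {4..CARD('n)} = (rest :: 'n set)"
proof -
  have "{1..CARD('n)} = {1, 2, 3} \<union> {4..CARD('n)}" using card4 by auto
  then have "(UNIV :: 'n set) = ix ` ({1, 2, 3} \<union> {4..CARD('n)})"
    using bij_betw_ix[where ?'n = 'n] by (simp add: bij_betw_def)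
  moreover have "(ix ` {1, 2, 3} :: 'n set) \<inter> ix ` {4..CARD('n)} = {}"
  proof (rule ccontr)
    assume "(ix ` {1, 2, 3} :: 'n set) \<inter> ix ` {4..CARD('n)} \<noteq> {}"
    then obtain i j where "i \<in> {1, 2, 3}" "j \<in> {4..CARD('n)}" "(ix i :: 'n) = ix j" by blast
    then show False using card4 ix_eq_iff[of i j] by auto
  qed
  ultimately have "ix ` {4..CARD('n)} = - (ix ` {1, 2, 3} :: 'n set)"
    unfolding image_Un by blast
  then show ?thesis
    by (simp only: rest_def i1_def i2_def i3_def image_insert image_empty)
qed

lemma rest_nonempty: "(rest :: 'n set) \<noteq> {}"
  using card4 by (simp flip: image_ix_rest)

lemma index_cases:
  fixes p :: 'n
  obtains "p = i1" | "p = i2" | "p = i3" | "p \<in> rest"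
  unfolding rest_def by blast

lemma sum_blocks: "(\<Sum>k\<in>(UNIV :: 'n set). f k) = f i1 + f i2 + f i3 + (\<Sum>k\<in>rest. f k :: real)"
proof -
  have "(UNIV :: 'n set) = insert i1 (insert i2 (insert i3 rest))" unfolding rest_def by blast
  then have "(\<Sum>k\<in>(UNIV :: 'n set). f k) = (\<Sum>k\<in>insert i1 (insert i2 (insert i3 rest)). f k)"
    by (rule arg_cong)
  then show ?thesis by (simp add: add.assoc)
qed

section \<open>Conjugation by B in coordinates\<close>

lemma B_component:
  "(B :: 'n mat) $ p $ q =
     (if p = i1 \<and> q = i1 then 1
      else if p = i2 \<and> q = i2 \<or> p = i3 \<and> q = i3 then 1 / 2
      else if p = i2 \<and> q = i3 then sqrt 3 / 2
      else if p = i3 \<and> q = i2 then - (sqrt 3 / 2)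
      else if p = q then - 1 else 0)"
  by (simp only: B_def i1_def i2_def i3_def vec_lambda_beta)

lemma sum_B_row:
  "(\<Sum>k\<in>UNIV. (B :: 'n mat) $ i1 $ k * f k) = f i1"
  "(\<Sum>k\<in>UNIV. (B :: 'n mat) $ i2 $ k * f k) = f i2 / 2 + sqrt 3 / 2 * f i3"
  "(\<Sum>k\<in>UNIV. (B :: 'n mat) $ i3 $ k * f k) = - (sqrt 3 / 2 * f i2) + f i3 / 2"
  "j \<in> rest \<Longrightarrow> (\<Sum>k\<in>UNIV. (B :: 'n mat) $ j $ k * f k) = - f j"
proof -
  show "(\<Sum>k\<in>UNIV. (B :: 'n mat) $ i1 $ k * f k) = f i1"
    "(\<Sum>k\<in>UNIV. (B :: 'n mat) $ i2 $ k * f k) = f i2 / 2 + sqrt 3 / 2 * f i3"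
    "(\<Sum>k\<in>UNIV. (B :: 'n mat) $ i3 $ k * f k) = - (sqrt 3 / 2 * f i2) + f i3 / 2"
    by (simp_all add: sum_blocks B_component)
  assume j: "j \<in> rest"
  then have "(B :: 'n mat) $ j $ k * f k = (if k = j then - f j else 0)" for k
    by (auto simp: B_component)
  then show "(\<Sum>k\<in>UNIV. (B :: 'n mat) $ j $ k * f k) = - f j" by simp
qed

lemma B_mult_component:
  fixes X :: "'n mat"
  shows "(B ** X) $ i1 $ q = X $ i1 $ q"
    "(B ** X) $ i2 $ q = X $ i2 $ q / 2 + sqrt 3 / 2 * X $ i3 $ q"
    "(B ** X) $ i3 $ q = - (sqrt 3 / 2 * X $ i2 $ q) + X $ i3 $ q / 2"
    "j \<in> rest \<Longrightarrow> (B ** X) $ j $ q = - X $ j $ q"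
  by (simp_all add: matrix_matrix_mult_def sum_B_row)

lemma mult_transpose_B_component:
  fixes X :: "'n mat"
  shows "(X ** transpose B) $ p $ i1 = X $ p $ i1"
    "(X ** transpose B) $ p $ i2 = X $ p $ i2 / 2 + sqrt 3 / 2 * X $ p $ i3"
    "(X ** transpose B) $ p $ i3 = - (sqrt 3 / 2 * X $ p $ i2) + X $ p $ i3 / 2"
    "j \<in> rest \<Longrightarrow> (X ** transpose B) $ p $ j = - X $ p $ j"
proof -
  have *: "(X ** transpose B) $ p $ q = (B ** transpose X) $ q $ p" for q
    by (simp add: matrix_matrix_mult_def transpose_def mult.commute)
  show "(X ** transpose B) $ p $ i1 = X $ p $ i1"
    "(X ** transpose B) $ p $ i2 = X $ p $ i2 / 2 + sqrt 3 / 2 * X $ p $ i3"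
    "(X ** transpose B) $ p $ i3 = - (sqrt 3 / 2 * X $ p $ i2) + X $ p $ i3 / 2"
    "j \<in> rest \<Longrightarrow> (X ** transpose B) $ p $ j = - X $ p $ j"
    by (simp_all add: * B_mult_component) (simp_all add: transpose_def)
qed

lemma B_orthogonal: "orthogonal_matrix (B :: 'n mat)"
proof -
  have "(B ** transpose B :: 'n mat) $ p $ q = mat 1 $ p $ q" for p q
    by (cases p rule: index_cases; cases q rule: index_cases)
      (auto simp: mult_transpose_B_component B_component mat_def)
  then have "B ** transpose B = (mat 1 :: 'n mat)" by (simp add: vec_eq_iff)
  then show ?thesis
    by (simp add: orthogonal_matrix_def matrix_left_right_inverse)
qed

lemma phi_eq: "phi X = B ** X ** transpose (B :: 'n mat)"
  by (simp add: phi_def matrix_inv_orthogonal[OF B_orthogonal])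

lemma phi_linear: "linear (phi :: 'n mat \<Rightarrow> 'n mat)"
  by (simp add: linear_iff phi_eq matrix_distribs)

lemma phi_so: "X \<in> so \<Longrightarrow> phi X \<in> (so :: 'n mat set)"
  by (simp add: phi_eq so_conj)

text \<open>On the pairs of entries (12, 13) this is the rotation by -pi/3, on the pairs (2j, 3j)
  the rotation by 2 pi/3, on the entries 1j the factor -1. Hence \<open>phi\<close> has order 6, 3
  and 2 on \<mm>1, \<mm>2 and \<mm>3, and 1 is not an eigenvalue there.\<close>

lemma phi_component:
  fixes X :: "'n mat"
  shows "phi X $ i1 $ i2 = X $ i1 $ i2 / 2 + sqrt 3 / 2 * X $ i1 $ i3"
    "phi X $ i1 $ i3 = - (sqrt 3 / 2 * X $ i1 $ i2) + X $ i1 $ i3 / 2"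
    "j \<in> rest \<Longrightarrow> phi X $ i1 $ j = - X $ i1 $ j"
    "j \<in> rest \<Longrightarrow> phi X $ i2 $ j = - (X $ i2 $ j / 2 + sqrt 3 / 2 * X $ i3 $ j)"
    "j \<in> rest \<Longrightarrow> phi X $ i3 $ j = sqrt 3 / 2 * X $ i2 $ j - X $ i3 $ j / 2"
    "j \<in> rest \<Longrightarrow> k \<in> rest \<Longrightarrow> phi X $ j $ k = X $ j $ k"
  by (simp_all add: phi_eq mult_transpose_B_component B_mult_component)

text \<open>Plane rotations commute, so the skew-symmetric block on \<open>i2\<close>,
  \<open>i3\<close> is fixed; for a block that is not skew-symmetric this can fail.\<close>

lemma phi_component_23:
  fixes X :: "'n mat"
  assumes "X \<in> so"
  shows "phi X $ i2 $ i3 = X $ i2 $ i3"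
  using so_component[OF assms, of i2 i3] so_diagonal[OF assms]
  by (simp add: phi_eq mult_transpose_B_component B_mult_component field_simps)

lemma phi2_component:
  fixes X :: "'n mat"
  shows "phi (phi X) $ i1 $ i2 = - X $ i1 $ i2 / 2 + sqrt 3 / 2 * X $ i1 $ i3"
    "phi (phi X) $ i1 $ i3 = - (sqrt 3 / 2 * X $ i1 $ i2) - X $ i1 $ i3 / 2"
    "j \<in> rest \<Longrightarrow> phi (phi X) $ i1 $ j = X $ i1 $ j"
    "j \<in> rest \<Longrightarrow> phi (phi X) $ i2 $ j = - X $ i2 $ j / 2 + sqrt 3 / 2 * X $ i3 $ j"
    "j \<in> rest \<Longrightarrow> phi (phi X) $ i3 $ j = - (sqrt 3 / 2 * X $ i2 $ j) - X $ i3 $ j / 2"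
  by (simp_all add: phi_component field_simps)

lemma phi3_component:
  fixes X :: "'n mat"
  shows "phi (phi (phi X)) $ i1 $ i2 = - X $ i1 $ i2"
    "phi (phi (phi X)) $ i1 $ i3 = - X $ i1 $ i3"
    "j \<in> rest \<Longrightarrow> phi (phi (phi X)) $ i1 $ j = - X $ i1 $ j"
    "j \<in> rest \<Longrightarrow> phi (phi (phi X)) $ i2 $ j = X $ i2 $ j"
    "j \<in> rest \<Longrightarrow> phi (phi (phi X)) $ i3 $ j = X $ i3 $ j"
  by (simp_all add: phi_component[where X = "phi (phi X)"] phi2_component[where X = X] field_simps)

lemma phi4_component:
  fixes X :: "'n mat"
  shows "phi (phi (phi (phi X))) $ i1 $ i2 = - X $ i1 $ i2 / 2 - sqrt 3 / 2 * X $ i1 $ i3"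
    "phi (phi (phi (phi X))) $ i1 $ i3 = sqrt 3 / 2 * X $ i1 $ i2 - X $ i1 $ i3 / 2"
    "j \<in> rest \<Longrightarrow> phi (phi (phi (phi X))) $ i1 $ j = X $ i1 $ j"
    "j \<in> rest \<Longrightarrow> phi (phi (phi (phi X))) $ i2 $ j = - X $ i2 $ j / 2 - sqrt 3 / 2 * X $ i3 $ j"
    "j \<in> rest \<Longrightarrow> phi (phi (phi (phi X))) $ i3 $ j = sqrt 3 / 2 * X $ i2 $ j - X $ i3 $ j / 2"
  by (simp_all add: phi_component[where X = "phi (phi (phi X))"] phi3_component[where X = X] field_simps)

lemma phi5_component:
  fixes X :: "'n mat"
  shows "phi (phi (phi (phi (phi X)))) $ i1 $ i2 = X $ i1 $ i2 / 2 - sqrt 3 / 2 * X $ i1 $ i3"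
    "phi (phi (phi (phi (phi X)))) $ i1 $ i3 = sqrt 3 / 2 * X $ i1 $ i2 + X $ i1 $ i3 / 2"
    "j \<in> rest \<Longrightarrow> phi (phi (phi (phi (phi X)))) $ i1 $ j = - X $ i1 $ j"
    "j \<in> rest \<Longrightarrow> phi (phi (phi (phi (phi X)))) $ i2 $ j = - X $ i2 $ j / 2 + sqrt 3 / 2 * X $ i3 $ j"
    "j \<in> rest \<Longrightarrow> phi (phi (phi (phi (phi X)))) $ i3 $ j = - (sqrt 3 / 2 * X $ i2 $ j) - X $ i3 $ j / 2"
  by (simp_all add: phi_component[where X = "phi (phi (phi (phi X)))"] phi4_component[where X = X] field_simps)

lemmas phi_components = phi_component(1-5) phi2_component phi3_component phi4_component phi5_component

text \<open>The projection to \<open>\<mm>\<close> along \<open>\<hh>\<close>: averaging over the powers of \<open>\<phi>\<close> projects to its fixed points.\<close>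

definition proj :: "'n mat \<Rightarrow> 'n mat" where
  "proj S = S - (1 / 6) *\<^sub>R (S + phi S + phi (phi S) + phi (phi (phi S)) + phi (phi (phi (phi S)))
     + phi (phi (phi (phi (phi S)))))"

lemma proj_linear: "linear proj"
  unfolding linear_iff
  by (simp add: proj_def linear_add[OF phi_linear] linear_scale[OF phi_linear] algebra_simps)

lemma proj_in_\<mm>:
  assumes "S \<in> so"
  shows "proj S \<in> \<mm>"
proof -
  \<comment> \<open>From the polynomial identity 1 - (1 + z + ... + z^5)/6 = (z - 1) (-(5 + 4z +
    3z^2 + 2z^3 + z^4)/6), evaluated at \<open>phi\<close>.\<close>
  let ?R = "(- (1 / 6)) *\<^sub>R (5 *\<^sub>R S + 4 *\<^sub>R phi S + 3 *\<^sub>R phi (phi S) + 2 *\<^sub>R phi (phi (phi S))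
     + phi (phi (phi (phi S))))"
  have "?R \<in> so"
    by (intro subspace_scale[OF subspace_so] subspace_add[OF subspace_so] phi_so assms)
  moreover have "proj S = phi ?R - ?R"
    by (simp add: proj_def linear_add[OF phi_linear] linear_diff[OF phi_linear]
        linear_neg[OF phi_linear] linear_scale[OF phi_linear] vec_eq_iff field_simps)
  ultimately show ?thesis unfolding \<mm>_def by (intro image_eqI)
qed

text \<open>On these entries \<open>phi\<close> acts by sixth roots of unity other than 1, so the
  sum of its six powers is zero there.\<close>

lemma proj_component:
  fixes X :: "'n mat"
  shows "proj X $ i1 $ i2 = X $ i1 $ i2" "proj X $ i1 $ i3 = X $ i1 $ i3"
    "j \<in> rest \<Longrightarrow> proj X $ i1 $ j = X $ i1 $ j"
    "j \<in> rest \<Longrightarrow> proj X $ i2 $ j = X $ i2 $ j"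
    "j \<in> rest \<Longrightarrow> proj X $ i3 $ j = X $ i3 $ j"
  by (simp_all add: proj_def phi_components[where X = X] field_simps)

lemma so_eqI:
  fixes x y :: "'n mat"
  assumes "x \<in> so" "y \<in> so" "x $ i1 $ i2 = y $ i1 $ i2" "x $ i1 $ i3 = y $ i1 $ i3"
    "x $ i2 $ i3 = y $ i2 $ i3" "\<And>j. j \<in> rest \<Longrightarrow> x $ i1 $ j = y $ i1 $ j"
    "\<And>j. j \<in> rest \<Longrightarrow> x $ i2 $ j = y $ i2 $ j" "\<And>j. j \<in> rest \<Longrightarrow> x $ i3 $ j = y $ i3 $ j"
    "\<And>j k. j \<in> rest \<Longrightarrow> k \<in> rest \<Longrightarrow> x $ j $ k = y $ j $ k"
  shows "x = y"
proof -
  have "x $ p $ q = y $ p $ q" for p q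
    using assms(3-) so_diagonal[OF assms(1), of p] so_diagonal[OF assms(2), of p]
      so_component[OF assms(1), of p q] so_component[OF assms(2), of p q]
    by (cases p rule: index_cases; cases q rule: index_cases) auto
  then show ?thesis by (simp add: vec_eq_iff)
qed

text \<open>For skew-symmetric matrices \<open>phi\<close> fixes the entry 23 and the entries with
  both indices in \<open>rest\<close>, so they cancel in \<open>phi X - X\<close>. Conversely, if
  they vanish, then \<open>x\<close> equals \<open>proj x\<close>, which lies in \<mm>.\<close>

lemma \<mm>_iff: "(x :: 'n mat) \<in> \<mm> \<longleftrightarrow> x \<in> so \<and> x $ i2 $ i3 = 0 \<and> (\<forall>j\<in>rest. \<forall>k\<in>rest. x $ j $ k = 0)"
proof
  assume "x \<in> \<mm>"
  then show "x \<in> so \<and> x $ i2 $ i3 = 0 \<and> (\<forall>j\<in>rest. \<forall>k\<in>rest. x $ j $ k = 0)"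
    by (auto simp: \<mm>_def phi_component phi_component_23 intro: subspace_diff[OF subspace_so] phi_so)
next
  assume x: "x \<in> so \<and> x $ i2 $ i3 = 0 \<and> (\<forall>j\<in>rest. \<forall>k\<in>rest. x $ j $ k = 0)"
  then have "proj x \<in> so" 
    unfolding proj_def
    by (intro subspace_diff[OF subspace_so] subspace_scale[OF subspace_so] subspace_add[OF subspace_so] phi_so) auto
  then have "proj x = x"
    using x by (intro so_eqI) (auto simp: proj_component, auto simp: proj_def phi_component phi_component_23 phi_so)
  with proj_in_\<mm>[of x] x show "x \<in> \<mm>" by simp
qed

lemma \<mm>_imp_so: "(x :: 'n mat) \<in> \<mm> \<Longrightarrow> x \<in> so" by (simp add: \<mm>_iff)

lemma subspace_\<mm>: "subspace (\<mm> :: 'n mat set)"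
proof -
  have "linear (\<lambda>X :: 'n mat. phi X - X)"
    using phi_linear by (simp add: linear_iff algebra_simps)
  then show ?thesis
    unfolding \<mm>_def by (rule linear_subspace_image[OF _ subspace_so])
qed

lemma \<mm>_eqI:
  fixes x y :: "'n mat"
  assumes "x \<in> \<mm>" "y \<in> \<mm>" "x $ i1 $ i2 = y $ i1 $ i2" "x $ i1 $ i3 = y $ i1 $ i3"
    "\<And>j. j \<in> rest \<Longrightarrow> x $ i1 $ j = y $ i1 $ j"
    "\<And>j. j \<in> rest \<Longrightarrow> x $ i2 $ j = y $ i2 $ j" "\<And>j. j \<in> rest \<Longrightarrow> x $ i3 $ j = y $ i3 $ j"
  shows "x = y"
  using assms by (intro so_eqI) (auto simp: \<mm>_iff)

lemma proj_\<mm>: "x \<in> \<mm> \<Longrightarrow> proj x = x"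
  using proj_in_\<mm>[of x] by (intro \<mm>_eqI) (auto simp: proj_component \<mm>_imp_so)

section \<open>The canonical f-structures\<close>

text \<open>\<open>f_type e\<^sub>1 e\<^sub>2 f\<close> says \<open>f = e\<^sub>1 J\<^sub>1 + e\<^sub>2 J\<^sub>2\<close> on \<open>\<mm>\<close>.\<close>

definition f_type :: "real \<Rightarrow> real \<Rightarrow> ('n mat \<Rightarrow> 'n mat) \<Rightarrow> bool" where
  "f_type e1 e2 f \<longleftrightarrow> linear f \<and> (\<forall>C x. C ** B = B ** C \<longrightarrow> orthogonal_matrix C \<longrightarrow>
       f (C ** x ** transpose C) = C ** f x ** transpose C) \<and>
     (\<forall>x\<in>\<mm>. f x \<in> \<mm> \<and> f x $ i1 $ i2 = e1 * x $ i1 $ i3 \<and> f x $ i1 $ i3 = - e1 * x $ i1 $ i2 \<and>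
       (\<forall>j\<in>rest. f x $ i1 $ j = 0 \<and> f x $ i2 $ j = - e2 * x $ i3 $ j \<and> f x $ i3 $ j = e2 * x $ i2 $ j))"

lemma phi_in_\<mm>: "(x :: 'n mat) \<in> \<mm> \<Longrightarrow> phi x \<in> \<mm>"
  by (auto simp: \<mm>_def linear_diff[OF phi_linear] intro: phi_so)

lemma phi_conj:
  fixes C :: "'n mat"
  assumes C: "C ** B = B ** C" and orth: "orthogonal_matrix C"
  shows "phi (C ** x ** transpose C) = C ** phi x ** transpose C"
proof -
  have "transpose C ** transpose B = transpose B ** transpose C"
    by (metis C matrix_transpose_mul)
  then show ?thesis
    unfolding phi_eq by (metis C matrix_mul_assoc)
qed

lemma canon_f_expand:
  fixes x :: "'n mat"
  shows "canon_f1 x = (1 / sqrt 3) *\<^sub>R (phi x - phi (phi (phi (phi (phi x)))))"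
    "canon_f2 x = (1 / (2 * sqrt 3)) *\<^sub>R (phi x - phi (phi x) + phi (phi (phi (phi x))) - phi (phi (phi (phi (phi x)))))"
    "canon_f3 x = (1 / (2 * sqrt 3)) *\<^sub>R (phi x + phi (phi x) - phi (phi (phi (phi x))) - phi (phi (phi (phi (phi x)))))"
    "canon_f4 x = (1 / sqrt 3) *\<^sub>R (phi (phi x) - phi (phi (phi (phi x))))"
  by (simp_all add: canon_f1_def canon_f2_def canon_f3_def canon_f4_def numeral_eq_Suc)

lemma canon_f_conj:
  fixes C :: "'n mat"
  assumes "C ** B = B ** C" "orthogonal_matrix C"
  shows "canon_f1 (C ** x ** transpose C) = C ** canon_f1 x ** transpose C"
    "canon_f2 (C ** x ** transpose C) = C ** canon_f2 x ** transpose C"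
    "canon_f3 (C ** x ** transpose C) = C ** canon_f3 x ** transpose C"
    "canon_f4 (C ** x ** transpose C) = C ** canon_f4 x ** transpose C"
  by (simp_all add: canon_f_expand phi_conj[OF assms] matrix_distribs)

lemma canon_f_linear:
  "linear (canon_f1 :: 'n mat \<Rightarrow> 'n mat)" "linear (canon_f2 :: 'n mat \<Rightarrow> 'n mat)"
  "linear (canon_f3 :: 'n mat \<Rightarrow> 'n mat)" "linear (canon_f4 :: 'n mat \<Rightarrow> 'n mat)"
  by (simp_all add: linear_iff canon_f_expand linear_add[OF phi_linear] linear_scale[OF phi_linear] algebra_simps)

lemma canon_f_in_\<mm>:
  assumes "(x :: 'n mat) \<in> \<mm>"
  shows "canon_f1 x \<in> \<mm>" "canon_f2 x \<in> \<mm>" "canon_f3 x \<in> \<mm>" "canon_f4 x \<in> \<mm>"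
  unfolding canon_f_expand
  by (intro subspace_scale[OF subspace_\<mm>] subspace_add[OF subspace_\<mm>] subspace_diff[OF subspace_\<mm>]
      phi_in_\<mm> assms)+

text \<open>As the fifth power of \<open>phi\<close> inverts it on these entries, \<open>phi\<close>
  minus its fifth power is twice the sine part of the rotations: sqrt 3 times J_1 + J_2. The second
  minus the fourth power gives sqrt 3 times J_1 - J_2, since doubling the angle flips the sign of
  the sine on \<mm>2 only. The other two structures are half the difference and half the
  sum.\<close>

lemma canon_f_component:
  fixes x :: "'n mat"
  shows "canon_f1 x $ i1 $ i2 = x $ i1 $ i3" "canon_f1 x $ i1 $ i3 = - x $ i1 $ i2"
    "canon_f2 x $ i1 $ i2 = 0" "canon_f2 x $ i1 $ i3 = 0"
    "canon_f3 x $ i1 $ i2 = x $ i1 $ i3" "canon_f3 x $ i1 $ i3 = - x $ i1 $ i2"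
    "canon_f4 x $ i1 $ i2 = x $ i1 $ i3" "canon_f4 x $ i1 $ i3 = - x $ i1 $ i2"
    "j \<in> rest \<Longrightarrow> canon_f1 x $ i1 $ j = 0" "j \<in> rest \<Longrightarrow> canon_f2 x $ i1 $ j = 0"
    "j \<in> rest \<Longrightarrow> canon_f3 x $ i1 $ j = 0" "j \<in> rest \<Longrightarrow> canon_f4 x $ i1 $ j = 0"
    "j \<in> rest \<Longrightarrow> canon_f1 x $ i2 $ j = - x $ i3 $ j" "j \<in> rest \<Longrightarrow> canon_f1 x $ i3 $ j = x $ i2 $ j"
    "j \<in> rest \<Longrightarrow> canon_f2 x $ i2 $ j = - x $ i3 $ j" "j \<in> rest \<Longrightarrow> canon_f2 x $ i3 $ j = x $ i2 $ j"
    "j \<in> rest \<Longrightarrow> canon_f3 x $ i2 $ j = 0" "j \<in> rest \<Longrightarrow> canon_f3 x $ i3 $ j = 0"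
    "j \<in> rest \<Longrightarrow> canon_f4 x $ i2 $ j = x $ i3 $ j" "j \<in> rest \<Longrightarrow> canon_f4 x $ i3 $ j = - x $ i2 $ j"
  by (simp_all add: canon_f_expand phi_components[where X = x] field_simps)

lemma f_type_canon: "f_type 1 1 canon_f1" "f_type 0 1 canon_f2" "f_type 1 0 canon_f3" "f_type 1 (- 1) canon_f4"
  unfolding f_type_def
  by (simp_all add: canon_f_conj canon_f_linear canon_f_in_\<mm> canon_f_component)

section \<open>Invariant metrics\<close>

lemma inner_mat: "X \<bullet> Y = (\<Sum>p\<in>UNIV. \<Sum>q\<in>UNIV. X $ p $ q * Y $ p $ q)" for X Y :: "'n mat"
  by (simp add: inner_vec_def)

text \<open>Only the \<mm>-entries of \<open>w\<close> meet nonzero entries of \<open>z\<close>, and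
  each of them occurs twice by skew-symmetry.\<close>

lemma inner_so_\<mm>:
  fixes w z :: "'n mat"
  assumes "w \<in> so" and "z \<in> \<mm>"
  shows "w \<bullet> z = 2 * (w $ i1 $ i2 * z $ i1 $ i2 + w $ i1 $ i3 * z $ i1 $ i3
    + (\<Sum>j\<in>rest. w $ i1 $ j * z $ i1 $ j + w $ i2 $ j * z $ i2 $ j + w $ i3 $ j * z $ i3 $ j))"
proof -
  have z: "z \<in> so" using assms(2) by (rule \<mm>_imp_so)
  have sym: "w $ q $ p * z $ q $ p = w $ p $ q * z $ p $ q" for p q
    using so_component[OF assms(1), of p q] so_component[OF z, of p q] by simp
  have z0: "z $ i2 $ i3 = 0" "\<And>j k. j \<in> rest \<Longrightarrow> k \<in> rest \<Longrightarrow> z $ j $ k = 0"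
    using assms(2) by (auto simp: \<mm>_iff)
  have row: "(\<Sum>q\<in>UNIV. w $ j $ q * z $ j $ q) =
     w $ i1 $ j * z $ i1 $ j + w $ i2 $ j * z $ i2 $ j + w $ i3 $ j * z $ i3 $ j" if "j \<in> rest" for j
    using that z0(2) by (simp add: sum_blocks sym[of j])
  have "w \<bullet> z = (\<Sum>q\<in>UNIV. w $ i1 $ q * z $ i1 $ q) + (\<Sum>q\<in>UNIV. w $ i2 $ q * z $ i2 $ q)
      + (\<Sum>q\<in>UNIV. w $ i3 $ q * z $ i3 $ q)
      + (\<Sum>j\<in>rest. w $ i1 $ j * z $ i1 $ j + w $ i2 $ j * z $ i2 $ j + w $ i3 $ j * z $ i3 $ j)"
    unfolding inner_mat by (subst sum_blocks) (simp add: row)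
  then show ?thesis
    using z0(1) sym[of i2 i1] sym[of i3 i1] sym[of i3 i2] so_diagonal[OF z]
    by (simp add: sum_blocks sum.distrib)
qed

section \<open>The three blocks and the weighted inner product\<close>

lemma keep_entries_component:
  fixes S :: "'n mat"
  shows "keep_entries ({a} \<times> I) S $ p $ q =
      (if p = ix a \<and> q \<in> ix ` I \<or> q = ix a \<and> p \<in> ix ` I then S $ p $ q else 0)"
    "keep_entries ({a, b} \<times> I) S $ p $ q =
      (if p \<in> {ix a, ix b} \<and> q \<in> ix ` I \<or> q \<in> {ix a, ix b} \<and> p \<in> ix ` I then S $ p $ q else 0)"
  unfolding keep_entries_def vec_lambda_beta by (rule if_cong; auto)+

lemma parts_component:
  fixes S :: "'n mat"
  shows "\<mm>1_part S $ p $ q = (if p = i1 \<and> q \<in> {i2, i3} \<or> q = i1 \<and> p \<in> {i2, i3} then S $ p $ q else 0)"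
    "\<mm>2_part S $ p $ q = (if p \<in> {i2, i3} \<and> q \<in> rest \<or> q \<in> {i2, i3} \<and> p \<in> rest then S $ p $ q else 0)"
    "\<mm>3_part S $ p $ q = (if p = i1 \<and> q \<in> rest \<or> q = i1 \<and> p \<in> rest then S $ p $ q else 0)"
  unfolding \<mm>1_part_def \<mm>2_part_def \<mm>3_part_def keep_entries_component image_ix_rest
  by (simp_all add: i1_def i2_def i3_def)

lemma parts_in_\<mm>:
  assumes "(S :: 'n mat) \<in> so"
  shows "\<mm>1_part S \<in> \<mm>" "\<mm>2_part S \<in> \<mm>" "\<mm>3_part S \<in> \<mm>"
proof -
  have "\<mm>1_part S $ q $ p = - \<mm>1_part S $ p $ q" "\<mm>2_part S $ q $ p = - \<mm>2_part S $ p $ q"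
    "\<mm>3_part S $ q $ p = - \<mm>3_part S $ p $ q" for p q
    using so_component[OF assms, of p q] by (auto simp: parts_component)
  then have "\<mm>1_part S \<in> so" "\<mm>2_part S \<in> so" "\<mm>3_part S \<in> so"
    by (blast intro: soI)+
  then show "\<mm>1_part S \<in> \<mm>" "\<mm>2_part S \<in> \<mm>" "\<mm>3_part S \<in> \<mm>"
    by (simp_all add: \<mm>_iff parts_component)
qed

lemma inner_parts:
  fixes X Y :: "'n mat"
  shows "\<mm>1_part X \<bullet> \<mm>1_part Y = X \<bullet> \<mm>1_part Y" "\<mm>2_part X \<bullet> \<mm>2_part Y = X \<bullet> \<mm>2_part Y"
    "\<mm>3_part X \<bullet> \<mm>3_part Y = X \<bullet> \<mm>3_part Y"
  unfolding inner_mat by (auto intro!: sum.cong simp: parts_component)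

definition weight :: "real \<Rightarrow> real \<Rightarrow> 'n mat \<Rightarrow> 'n mat" where
  "weight s t S = \<mm>1_part S + s *\<^sub>R \<mm>2_part S + t *\<^sub>R \<mm>3_part S"

lemma weight_component:
  fixes S :: "'n mat"
  shows "weight s t S $ i1 $ i2 = S $ i1 $ i2" "weight s t S $ i1 $ i3 = S $ i1 $ i3"
    "j \<in> rest \<Longrightarrow> weight s t S $ i1 $ j = t * S $ i1 $ j"
    "j \<in> rest \<Longrightarrow> weight s t S $ i2 $ j = s * S $ i2 $ j"
    "j \<in> rest \<Longrightarrow> weight s t S $ i3 $ j = s * S $ i3 $ j"
  by (simp_all add: weight_def parts_component)

lemma weight_in_\<mm>: "S \<in> so \<Longrightarrow> weight s t S \<in> \<mm>"
  unfolding weight_def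
  by (intro subspace_add[OF subspace_\<mm>] subspace_scale[OF subspace_\<mm>] parts_in_\<mm>)

lemma weight_linear: "linear (weight s t)"
proof -
  have "linear (\<mm>1_part :: 'n mat \<Rightarrow> 'n mat)" "linear (\<mm>2_part :: 'n mat \<Rightarrow> 'n mat)"
    "linear (\<mm>3_part :: 'n mat \<Rightarrow> 'n mat)"
    by (auto simp: linear_iff vec_eq_iff parts_component)
  then show ?thesis by (simp add: linear_iff weight_def algebra_simps)
qed

text \<open>\<open>weight s t\<close> is a scalar on each of three orthogonal blocks and zero on
  \<hh>, hence self-adjoint.\<close>

lemma inner_weight_commute:
  fixes x y :: "'n mat"
  assumes "x \<in> so" "y \<in> so"
  shows "x \<bullet> weight s t y = weight s t x \<bullet> y"
proof -
  have "weight s t x \<bullet> y = y \<bullet> weight s t x" by (rule inner_commute)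
  then show ?thesis
    using assms by (simp add: inner_so_\<mm> weight_in_\<mm> weight_component algebra_simps)
qed

section \<open>The Killing form of so(n)\<close>

lemma mult_skew_component:
  fixes A :: "'n mat"
  assumes "p \<noteq> q"
  shows "(A ** skew p q) $ r $ k = (if k = q then A $ r $ p else if k = p then - A $ r $ q else 0)"
proof -
  have "A $ r $ l * skew p q $ l $ k =
     (if l = p then if k = q then A $ r $ p else 0 else 0)
     + (if l = q then if k = p then - A $ r $ q else 0 else 0)" for l
    using assms by (auto simp: skew_def)
  then show ?thesis
    using assms by (auto simp: matrix_matrix_mult_def sum.distrib)
qed

lemma skew_mult_component:
  fixes A :: "'n mat"
  assumes "p \<noteq> q"
  shows "(skew p q ** A) $ r $ k = (if r = p then A $ q $ k else if r = q then - A $ p $ k else 0)"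
proof -
  have "skew p q $ r $ l * A $ l $ k =
     (if l = q then if r = p then A $ q $ k else 0 else 0)
     + (if l = p then if r = q then - A $ p $ k else 0 else 0)" for l
    using assms by (auto simp: skew_def)
  then show ?thesis
    using assms by (auto simp: matrix_matrix_mult_def sum.distrib)
qed

text \<open>With E for \<open>skew p q\<close>, the double bracket is XYE - XEY - YEX + EYX. The
  outer terms give the two diagonal entries, and each middle term gives one copy of the product of
  the entries of \<open>X\<close> and \<open>Y\<close>.\<close>

lemma double_bracket_skew:
  fixes X Y :: "'n mat"
  assumes XY: "X \<in> so" "Y \<in> so" and pq: "p \<noteq> q"
  shows "lie_bracket X (lie_bracket Y (skew p q)) $ p $ q =
    (X ** Y) $ p $ p + (X ** Y) $ q $ q + 2 * X $ p $ q * Y $ p $ q"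
proof -
  have mid: "(C ** skew p q ** D) $ p $ q = - (C $ p $ q * D $ p $ q)"
    if "C \<in> so" for C D :: "'n mat"
  proof -
    have "(C ** skew p q) $ p $ k * D $ k $ q = (if k = p then - (C $ p $ q * D $ p $ q) else 0)" for k
      using pq so_diagonal[OF that] by (simp add: mult_skew_component)
    then show ?thesis by (simp add: matrix_matrix_mult_def[of "C ** skew p q"])
  qed
  have "(Y ** X) $ q $ q = (X ** Y) $ q $ q"
  proof -
    have "transpose (X ** Y) = Y ** X"
      using XY by (simp add: so_def matrix_transpose_mul matrix_distribs)
    moreover have "transpose (X ** Y) $ q $ q = (X ** Y) $ q $ q" by (simp add: transpose_def)
    ultimately show ?thesis by simp
  qed
  moreover have "(X ** Y ** skew p q) $ p $ q = (X ** Y) $ p $ p"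
    "(skew p q ** (Y ** X)) $ p $ q = (Y ** X) $ q $ q"
    using pq by (simp_all add: mult_skew_component skew_mult_component)
  ultimately show ?thesis
    using mid[OF XY(1), of Y] mid[OF XY(2), of X]
    by (simp add: lie_bracket_def matrix_distribs matrix_mul_assoc)
qed

text \<open>This turns the sum over labels i < j in \<open>killing_form\<close> into full sums over
  the index type, where traces and inner products can be recognized.\<close>

lemma sum_index_pairs:
  fixes h :: "'n \<Rightarrow> 'n \<Rightarrow> real"
  assumes sym: "\<And>p q. h p q = h q p"
  shows "2 * (\<Sum>(i, j) \<in> {(i, j). 1 \<le> i \<and> i < j \<and> j \<le> CARD('n)}. h (ix i) (ix j))
    = (\<Sum>p\<in>UNIV. \<Sum>q\<in>UNIV. h p q) - (\<Sum>p\<in>UNIV. h p p)"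
proof -
  let ?N = "{1..CARD('n)}"
  let ?L = "{(i, j). 1 \<le> i \<and> i < j \<and> j \<le> CARD('n)}"
  let ?U = "{(i, j). 1 \<le> j \<and> j < i \<and> i \<le> CARD('n)}"
  let ?D = "(\<lambda>i. (i, i)) ` ?N"
  let ?h = "\<lambda>(i, j). h (ix i) (ix j)"
  have fin: "finite ?L" "finite ?U" "finite ?D"
    by (rule finite_subset[of _ "?N \<times> ?N"]; auto)+
  have diag: "(\<Sum>p\<in>UNIV. h p p) = sum ?h ?D"
    by (subst sum.reindex_bij_betw[OF bij_betw_ix[where ?'n = 'n], symmetric])
      (simp add: sum.reindex inj_on_def)
  have "(\<Sum>p\<in>UNIV. \<Sum>q\<in>UNIV. h p q) = (\<Sum>i\<in>?N. \<Sum>j\<in>?N. h (ix i) (ix j))"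
    by (simp only: sum.reindex_bij_betw[OF bij_betw_ix[where ?'n = 'n], symmetric])
  also have "\<dots> = sum ?h (?N \<times> ?N)"
    by (rule sum.cartesian_product)
  also have "?N \<times> ?N = ?L \<union> ?U \<union> ?D" by auto
  also have "sum ?h (?L \<union> ?U \<union> ?D) = sum ?h ?L + sum ?h ?U + sum ?h ?D"
    using fin by (subst sum.union_disjoint; (subst sum.union_disjoint)?) auto
  also have "sum ?h ?U = sum ?h ?L"
    by (rule sum.reindex_bij_witness[where i = "\<lambda>(i, j). (j, i)" and j = "\<lambda>(i, j). (j, i)"])
      (auto intro: sym)
  finally show ?thesis using diag by simp
qed

text \<open>The classical formula K(X, Y) = (n - 2) tr(XY), with tr(XY) equal to
  \<open>- (X \<bullet> Y)\<close> on skew-symmetric matrices.\<close>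

lemma killing_form_eq:
  fixes X Y :: "'n mat"
  assumes XY: "X \<in> so" "Y \<in> so"
  shows "killing_form X Y = - (real CARD('n) - 2) * (X \<bullet> Y)"
proof -
  define h where "h p q = (X ** Y) $ p $ p + (X ** Y) $ q $ q + 2 * X $ p $ q * Y $ p $ q" for p q
  have sym: "h p q = h q p" for p q
    using so_component[OF XY(1), of p q] so_component[OF XY(2), of p q] by (simp add: h_def)
  have tr: "(\<Sum>p\<in>UNIV. (X ** Y) $ p $ p) = - (X \<bullet> Y)"
  proof -
    have "X $ p $ k * Y $ k $ p = - (X $ p $ k * Y $ p $ k)" for p k
      using so_component[OF XY(2), of p k] by simp
    then have "(X ** Y) $ p $ p = - (\<Sum>k\<in>UNIV. X $ p $ k * Y $ p $ k)" for p
      by (simp only: matrix_matrix_mult_def vec_lambda_beta sum_negf)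
    then show ?thesis by (simp add: inner_mat sum_negf)
  qed
  have "killing_form X Y = (\<Sum>(i, j) \<in> {(i, j). 1 \<le> i \<and> i < j \<and> j \<le> CARD('n)}. h (ix i) (ix j))"
    unfolding killing_form_def
  proof (rule sum.cong[OF refl], clarify)
    fix i j :: nat assume ij: "1 \<le> i" "i < j" "j \<le> CARD('n)"
    then have "(ix i :: 'n) \<noteq> ix j" by (subst ix_eq_iff) auto
    then show "entry (lie_bracket X (lie_bracket Y (skew_unit i j))) i j = h (ix i) (ix j)"
      using double_bracket_skew[OF XY]
      by (simp add: entry_def h_def skew_unit_def flip: skew_def)
  qed
  moreover have "(\<Sum>p\<in>UNIV. h p p) = - (2 * (X \<bullet> Y))"
    by (simp add: h_def so_diagonal[OF XY(1)] tr flip: sum_distrib_left)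
  moreover have "(\<Sum>p\<in>UNIV. \<Sum>q\<in>UNIV. h p q) = - (2 * real CARD('n) * (X \<bullet> Y)) + 2 * (X \<bullet> Y)"
  proof -
    have "(\<Sum>p\<in>UNIV. \<Sum>q\<in>UNIV. 2 * X $ p $ q * Y $ p $ q) = 2 * (X \<bullet> Y)"
      by (simp add: inner_mat sum_distrib_left mult.assoc)
    moreover have "(\<Sum>p\<in>UNIV. \<Sum>q\<in>(UNIV :: 'n set). (X ** Y) $ p $ p) = - (real CARD('n) * (X \<bullet> Y))"
      "(\<Sum>p\<in>(UNIV :: 'n set). \<Sum>q\<in>UNIV. (X ** Y) $ q $ q) = - (real CARD('n) * (X \<bullet> Y))"
      by (simp_all add: tr flip: sum_distrib_left)
    ultimately show ?thesis
      unfolding h_def sum.distrib by simp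
  qed
  ultimately show ?thesis
    using sum_index_pairs[of h, OF sym] by (simp add: algebra_simps)
qed

lemma inv_metric_eq:
  fixes X Y :: "'n mat"
  assumes "X \<in> so" "Y \<in> so"
  shows "inv_metric s t X Y = (real CARD('n) - 2) * (X \<bullet> weight s t Y)"
  using assms
  by (simp add: inv_metric_def g0_def killing_form_eq \<mm>_imp_so parts_in_\<mm> inner_parts weight_def
      inner_add_right algebra_simps)

lemma inner_mult_left: "(A ** C) \<bullet> D = C \<bullet> (transpose A ** D)"
  and inner_mult_right: "(A ** C) \<bullet> D = A \<bullet> (D ** transpose C)" for A C D :: "'n mat"
proof -
  have "(A ** C) \<bullet> D = (\<Sum>p\<in>UNIV. \<Sum>q\<in>UNIV. \<Sum>k\<in>UNIV. A $ p $ k * C $ k $ q * D $ p $ q)"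
    by (simp add: inner_mat matrix_matrix_mult_def sum_distrib_right)
  also have "\<dots> = (\<Sum>q\<in>UNIV. \<Sum>p\<in>UNIV. \<Sum>k\<in>UNIV. A $ p $ k * C $ k $ q * D $ p $ q)"
    by (rule sum.swap)
  also have "\<dots> = (\<Sum>q\<in>UNIV. \<Sum>k\<in>UNIV. \<Sum>p\<in>UNIV. A $ p $ k * C $ k $ q * D $ p $ q)"
    by (intro sum.cong refl sum.swap)
  also have "\<dots> = (\<Sum>k\<in>UNIV. \<Sum>q\<in>UNIV. \<Sum>p\<in>UNIV. A $ p $ k * C $ k $ q * D $ p $ q)"
    by (rule sum.swap)
  also have "\<dots> = C \<bullet> (transpose A ** D)"
    by (simp add: inner_mat matrix_matrix_mult_def transpose_def sum_distrib_left mult_ac)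
  finally show "(A ** C) \<bullet> D = C \<bullet> (transpose A ** D)" .
  have "(A ** C) \<bullet> D = (\<Sum>p\<in>UNIV. \<Sum>q\<in>UNIV. \<Sum>k\<in>UNIV. A $ p $ k * C $ k $ q * D $ p $ q)"
    by (simp add: inner_mat matrix_matrix_mult_def sum_distrib_right)
  also have "\<dots> = (\<Sum>p\<in>UNIV. \<Sum>k\<in>UNIV. \<Sum>q\<in>UNIV. A $ p $ k * C $ k $ q * D $ p $ q)"
    by (intro sum.cong refl sum.swap)
  also have "\<dots> = A \<bullet> (D ** transpose C)"
    by (simp add: inner_mat matrix_matrix_mult_def transpose_def sum_distrib_left mult_ac)
  finally show "(A ** C) \<bullet> D = A \<bullet> (D ** transpose C)" .
qed

text \<open>Ad-invariance of the trace form; it isolates the test vector in Koszul's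
  formula.\<close>

lemma inner_lie_bracket:
  fixes x y z :: "'n mat"
  assumes "x \<in> so" "y \<in> so"
  shows "lie_bracket x y \<bullet> z = x \<bullet> lie_bracket y z"
proof -
  have "transpose y = - y" using assms by (simp_all add: so_def)
  then show ?thesis
    using inner_mult_left[of y x z] inner_mult_right[of x y z]
    by (simp add: lie_bracket_def inner_diff_left inner_diff_right matrix_distribs)
qed

section \<open>The isotropy group\<close>

lemma orthogonal_columns:
  "orthogonal_matrix A \<Longrightarrow> (\<Sum>k\<in>UNIV. A $ k $ p * A $ k $ q) = (if p = q then 1 else 0)"
  for A :: "'n mat"
proof -
  assume "orthogonal_matrix A"
  then have "(transpose A ** A) $ p $ q = mat 1 $ p $ q" by (simp add: orthogonal_matrix_def)
  then show ?thesis by (simp add: matrix_matrix_mult_def transpose_def mat_def)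
qed

lemma phi_fixed_imp_commute: "phi C = C \<Longrightarrow> C ** B = B ** C" for C :: "'n mat"
  using B_orthogonal unfolding phi_eq orthogonal_matrix_def
  by (metis matrix_mul_assoc matrix_mul_rid)

lemma SO_on_rest_commute:
  fixes A :: "'n mat"
  assumes "A \<in> SO_on rest"
  shows "A ** B = B ** A"
proof (rule phi_fixed_imp_commute)
  have A: "A $ p $ q = (if p = q then 1 else 0)" if "p \<notin> rest \<or> q \<notin> rest" for p q
    using assms that by (auto simp: SO_on_def)
  have "phi A $ p $ q = A $ p $ q" for p q
    unfolding phi_eq
    by (cases p rule: index_cases; cases q rule: index_cases)
      (simp_all add: mult_transpose_B_component B_mult_component A)
  then show "phi A = A" by (simp add: vec_eq_iff)
qed

lemma SO_on_rotation:
  fixes A :: "'n mat"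
  assumes "A \<in> SO_on {i2, i3}"
  shows "A $ i3 $ i3 = A $ i2 $ i2 \<and> A $ i2 $ i3 = - A $ i3 $ i2"
proof -
  have A: "A $ p $ q = (if p = q then 1 else 0)" if "p \<notin> {i2, i3} \<or> q \<notin> {i2, i3}" for p q
    using assms that by (auto simp: SO_on_def)
  have "orthogonal_matrix A" and det: "det A = 1" using assms by (auto simp: SO_on_def SO_def)
  note orth = orthogonal_columns[OF this(1)]
  let ?a = "A $ i2 $ i2" and ?b = "A $ i2 $ i3" and ?c = "A $ i3 $ i2" and ?d = "A $ i3 $ i3"
  have 1: "?a\<^sup>2 + ?c\<^sup>2 = 1" "?b\<^sup>2 + ?d\<^sup>2 = 1" "?a * ?b + ?c * ?d = 0"
    using orth[of i2 i2] orth[of i3 i3] orth[of i2 i3]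
    by (simp_all add: sum_blocks A power2_eq_square)
  have "(?d = ?a \<and> ?b = - ?c) \<or> (?d = - ?a \<and> ?b = ?c)"
  proof -
    \<comment> \<open>\<open>k\<close> is the determinant of the block; orthonormal columns force it
      to be 1 (rotation) or -1 (reflection).\<close>
    define k where "k = ?a * ?d - ?b * ?c"
    have "?b = - k * ?c" "?d = k * ?a" "k\<^sup>2 = 1"
      unfolding k_def using 1 by algebra+
    then show ?thesis by (auto simp: power2_eq_1_iff)
  qed
  moreover have False if refl: "?d = - ?a" "?b = ?c"
  proof -
    \<comment> \<open>To exclude a reflection without expanding \<open>det A\<close>:
      \<open>D\<close> flips the sign of column \<open>i3\<close>, which turns \<open>A\<close> into
      a rotation of determinant 1, whereas \<open>det A * det D\<close> is -1.\<close>
    define D :: "'n mat" where "D = (\<chi> p q. if p = q then if p = i3 then - 1 else 1 else 0)"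
    have "det D = (\<Prod>p\<in>UNIV. D $ p $ p)" by (rule det_diagonal) (simp add: D_def)
    also have "\<dots> = (\<Prod>p\<in>(UNIV :: 'n set). if p = i3 then - 1 else 1)" by (simp add: D_def)
    also have "\<dots> = - 1" by simp
    finally have detD: "det D = - 1" .
    have AD: "(A ** D) $ p $ q = (if q = i3 then - A $ p $ q else A $ p $ q)" for p q
    proof -
      have "A $ p $ k * D $ k $ q = (if k = q then if q = i3 then - A $ p $ q else A $ p $ q else 0)" for k
        by (simp add: D_def)
      then show ?thesis by (simp add: matrix_matrix_mult_def)
    qed
    from 1(1) have "?a\<^sup>2 + (- ?c)\<^sup>2 = 1" by simp
    then obtain \<theta> where \<theta>: "?a = cos \<theta>" "- ?c = sin \<theta>" using sincos_total_2pi by metis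
    then have A23: "A $ i2 $ i2 = cos \<theta>" "A $ i3 $ i2 = - sin \<theta>" "A $ i2 $ i3 = - sin \<theta>"
      "A $ i3 $ i3 = - cos \<theta>"
      using refl by auto
    have "(A ** D) $ p $ q = rotation (skew i2 i3) \<theta> $ p $ q" for p q
    proof (cases "p \<in> {i2, i3} \<and> q \<in> {i2, i3}")
      case True
      then show ?thesis
        by (elim conjE insertE emptyE)
          (simp_all add: AD A23 rotation_def skew_square mat_def, simp_all add: skew_def)
    next
      case False
      then have "skew i2 i3 $ p $ q = 0" by (auto simp: skew_def)
      with False show ?thesis by (auto simp: AD rotation_def skew_square mat_def A)
    qed
    then have "A ** D = rotation (skew i2 i3) \<theta>" by (simp add: vec_eq_iff)
    moreover have "rotation (skew i2 i3) \<theta> \<in> (SO :: 'n mat set)"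
      by (intro rotation_in_SO skew_in_so skew_cube) auto
    ultimately show False using det detD det_mul[of A D] by (simp add: SO_def)
  qed
  ultimately show ?thesis by blast
qed

lemma SO_on_23_commute:
  fixes A :: "'n mat"
  assumes "A \<in> SO_on {i2, i3}"
  shows "A ** B = B ** A"
proof (rule phi_fixed_imp_commute)
  have A: "A $ p $ q = (if p = q then 1 else 0)" if "p \<notin> {i2, i3} \<or> q \<notin> {i2, i3}" for p q
    using assms that by (auto simp: SO_on_def)
  have "phi A $ p $ q = A $ p $ q" for p q
    unfolding phi_eq
    by (cases p rule: index_cases; cases q rule: index_cases)
      (simp_all add: mult_transpose_B_component B_mult_component A SO_on_rotation[OF assms] field_simps)
  then show "phi A = A" by (simp add: vec_eq_iff)
qed

lemma H_SO: "h \<in> (H :: 'n mat set) \<Longrightarrow> h \<in> SO"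
  by (auto simp: H_def SO_on_def intro: SO_mult)

text \<open>\<open>H\<close> lies in the fixed point group of conjugation by \<open>B\<close>;
  equivariance of fields, of \<open>proj\<close> and of the canonical structures all rest on
  this.\<close>

lemma H_commute:
  assumes "h \<in> (H :: 'n mat set)"
  shows "h ** B = B ** h"
proof -
  obtain C D where h: "h = C ** D" "C \<in> SO_on (ix ` {2, 3})" "D \<in> SO_on (ix ` {4..CARD('n)})"
    using assms by (auto simp: H_def)
  then have "C \<in> SO_on {i2, i3}" "D \<in> SO_on rest"
    by (simp_all add: i2_def i3_def image_ix_rest)
  then show ?thesis
    unfolding h(1) by (metis SO_on_23_commute SO_on_rest_commute matrix_mul_assoc)
qed

section \<open>Vector fields\<close>

lemma H_transpose_commute:
  assumes "h \<in> (H :: 'n mat set)"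
  shows "transpose h ** B = B ** transpose h" "orthogonal_matrix (transpose h)"
proof -
  show "orthogonal_matrix (transpose h)" using H_SO[OF assms] by (simp add: SO_def)
  have "transpose h ** (h ** B) ** transpose h = transpose h ** (B ** h) ** transpose h"
    by (simp only: H_commute[OF assms])
  then show "transpose h ** B = B ** transpose h"
    by (simp add: SO_cancel[OF H_SO[OF assms]] flip: matrix_mul_assoc)
qed

lemma proj_conj:
  fixes C :: "'n mat"
  assumes "C ** B = B ** C" "orthogonal_matrix C"
  shows "proj (C ** x ** transpose C) = C ** proj x ** transpose C"
  by (simp add: proj_def phi_conj[OF assms] matrix_distribs)

text \<open>This is the lift of the fundamental vector field of the left action generated by
  \<open>W\<close>: at \<open>A H\<close> it takes the \<mm>-part of Ad of the inverse of
  \<open>A\<close> applied to \<open>W\<close>.\<close>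

lemma vector_field_killing:
  assumes "W \<in> so"
  shows "vector_field (\<lambda>A :: 'n mat. proj (transpose A ** W ** A))"
  unfolding vector_field_def
proof (intro conjI ballI)
  have "Ck_on k (\<lambda>A :: 'n mat. transpose A ** W ** A) UNIV" for k
    by (intro Ck_on_bounded_bilinear[OF bounded_bilinear_matrix_mult] Ck_on_const Ck_on_ident
        Ck_on_bounded_linear[OF bounded_linear_transpose])
  then show "smooth_on SO (\<lambda>A :: 'n mat. proj (transpose A ** W ** A))"
    using proj_linear
    by (intro smooth_on_global Ck_on_bounded_linear[where L = proj]) (simp_all add: linear_conv_bounded_linear)
  show "proj (transpose A ** W ** A) \<in> \<mm>" for A
    using proj_in_\<mm>[OF so_conj[OF assms, of "transpose A"]] by simp
  fix A h :: "'n mat" assume "A \<in> SO" "h \<in> H"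
  have "transpose (A ** h) ** W ** (A ** h) = transpose h ** (transpose A ** W ** A) ** transpose (transpose h)"
    by (simp add: matrix_transpose_mul matrix_mul_assoc)
  then show "proj (transpose (A ** h) ** W ** (A ** h)) = matrix_inv h ** proj (transpose A ** W ** A) ** h"
    using proj_conj[OF H_transpose_commute[OF \<open>h \<in> H\<close>], of "transpose A ** W ** A"]
    by (simp add: matrix_inv_SO[OF H_SO[OF \<open>h \<in> H\<close>]])
qed

lemma vector_field_at:
  assumes "A \<in> SO" "z \<in> (\<mm> :: 'n mat set)"
  obtains Z where "vector_field Z" "Z A = z"
proof
  show "vector_field (\<lambda>C. proj (transpose C ** (A ** z ** transpose A) ** C))"
    by (intro vector_field_killing so_conj \<mm>_imp_so assms)
  have "transpose A ** (A ** z ** transpose A) ** A = z"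
    by (metis SO_cancel(1)[OF assms(1)] matrix_mul_assoc matrix_mul_lid matrix_mul_rid)
  then show "proj (transpose A ** (A ** z ** transpose A) ** A) = z"
    by (simp add: proj_\<mm> assms(2))
qed

text \<open>Because \<open>H\<close> commutes with \<open>B\<close>, the conjugate of
  \<open>B\<close> by \<open>A\<close> depends only on the coset \<open>A H\<close>; its entries are
  the test functions for the bracket.\<close>

lemma smooth_function_orbit: "smooth_function (\<lambda>A :: 'n mat. (A ** B ** transpose A) $ p $ q)"
  unfolding smooth_function_def
proof (intro conjI ballI)
  have "bounded_linear (\<lambda>S :: 'n mat. S $ p $ q)"
    by (intro bounded_linear_compose[OF bounded_linear_vec_nth] bounded_linear_vec_nth)
  moreover have "Ck_on k (\<lambda>A :: 'n mat. A ** B ** transpose A) UNIV" for k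
    by (intro Ck_on_bounded_bilinear[OF bounded_bilinear_matrix_mult] Ck_on_const Ck_on_ident
        Ck_on_bounded_linear[OF bounded_linear_transpose])
  ultimately show "smooth_on SO (\<lambda>A :: 'n mat. (A ** B ** transpose A) $ p $ q)"
    by (intro smooth_on_global Ck_on_bounded_linear[where L = "\<lambda>S. S $ p $ q"])
  fix A h :: "'n mat" assume "h \<in> H"
  then have "h ** (B ** C) = B ** (h ** C)" for C :: "'n mat"
    by (simp add: matrix_mul_assoc H_commute)
  then have "A ** h ** B ** transpose (A ** h) = A ** B ** transpose A"
    by (simp add: matrix_transpose_mul SO_cancel[OF H_SO[OF \<open>h \<in> H\<close>]] flip: matrix_mul_assoc)
  then show "(A ** h ** B ** transpose (A ** h)) $ p $ q = (A ** B ** transpose A) $ p $ q"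
    by simp
qed

lemma vector_field_in_\<mm>: "vector_field X \<Longrightarrow> A \<in> SO \<Longrightarrow> X A \<in> (\<mm> :: 'n mat set)"
  by (simp add: vector_field_def)

lemma vector_field_in_so: "vector_field X \<Longrightarrow> A \<in> SO \<Longrightarrow> X A \<in> (so :: 'n mat set)"
  by (simp add: vector_field_in_\<mm> \<mm>_imp_so)

lemma vector_field_derivative:
  assumes "vector_field Y" "A \<in> (SO :: 'n mat set)"
  shows "(Y has_derivative frechet_derivative Y (at A within SO)) (at A within SO)"
  using assms smooth_on_imp_differentiable[of SO Y A]
  by (simp add: vector_field_def flip: frechet_derivative_works)

section \<open>The Lie bracket of lifted vector fields\<close>

text \<open>\<mm> is cut out by the linear equations of skew-symmetry and of being fixed by
  \<open>proj\<close>. Composed with \<open>Y\<close> they are constantly zero on \<open>SO\<close>,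
  so their derivatives along tangent vectors vanish.\<close>

lemma lift_deriv_in_\<mm>:
  assumes X: "X A \<in> so" and Y: "vector_field Y" and A: "A \<in> (SO :: 'n mat set)"
  shows "lift_deriv X Y A \<in> \<mm>"
proof -
  have zero: "L (lift_deriv X Y A) = 0" if "linear L" "\<And>y. y \<in> \<mm> \<Longrightarrow> L y = 0" for L :: "'n mat \<Rightarrow> 'n mat"
    unfolding lift_deriv_def
    by (rule derivative_tangent_zero[OF linear_has_derivative[OF that(1) vector_field_derivative[OF Y A]] A])
      (use X vector_field_in_\<mm>[OF Y] that(2) in auto)
  have "transpose (lift_deriv X Y A) + lift_deriv X Y A = 0"
    by (rule zero[of "\<lambda>S. transpose S + S"])
      (auto simp: linear_iff transpose_add transpose_scaleR algebra_simps so_def dest!: \<mm>_imp_so)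
  then have "lift_deriv X Y A \<in> so" by (simp add: so_def eq_neg_iff_add_eq_0)
  moreover have "lift_deriv X Y A - proj (lift_deriv X Y A) = 0"
    by (rule zero[of "\<lambda>S. S - proj S"])
      (auto simp: linear_iff linear_add[OF proj_linear] linear_scale[OF proj_linear] algebra_simps proj_\<mm>)
  ultimately show ?thesis using proj_in_\<mm> by fastforce
qed

lemma deriv_along_orbit:
  assumes Y: "vector_field Y" and A: "A \<in> (SO :: 'n mat set)"
  shows "deriv_along Y (\<lambda>A. (A ** B ** transpose A) $ p $ q) A
     = (A ** lie_bracket (Y A) B ** transpose A) $ p $ q"
proof -
  have nth: "linear (\<lambda>S :: 'n mat. S $ p $ q)" by (simp add: linear_iff)
  have tr: "(transpose has_derivative transpose) (at A within SO)"
    by (rule bounded_linear_imp_has_derivative[OF bounded_linear_transpose])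
  have "((\<lambda>A. (A ** B ** transpose A) $ p $ q) has_derivative
      (\<lambda>v. (A ** B ** transpose v + (A ** 0 + v ** B) ** transpose A) $ p $ q)) (at A within SO)"
    by (intro linear_has_derivative[OF nth] has_derivative_matrix_mult tr has_derivative_ident has_derivative_const)
  from deriv_along_eq[where X = Y and A = A and v = "\<lambda>A. (A ** B ** transpose A) $ p $ q", OF this refl A vector_field_in_so[OF Y A]]
  show ?thesis
    using vector_field_in_so[OF Y A]
    by (simp add: matrix_transpose_mul so_def lie_bracket_def matrix_distribs matrix_mul_assoc)
qed

text \<open>Differentiating the two outer factors produces the iterated bracket, and differentiating
  \<open>Y\<close> produces the second term.\<close>

lemma deriv_along_deriv_along_orbit:
  assumes X: "vector_field X" and Y: "vector_field Y" and A: "A \<in> (SO :: 'n mat set)"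
  shows "deriv_along X (deriv_along Y (\<lambda>A. (A ** B ** transpose A) $ p $ q)) A
     = (A ** (lie_bracket (X A) (lie_bracket (Y A) B) + lie_bracket (lift_deriv X Y A) B) ** transpose A) $ p $ q"
proof -
  let ?DY = "frechet_derivative Y (at A within SO)"
  have nth: "linear (\<lambda>S :: 'n mat. S $ p $ q)" by (simp add: linear_iff)
  have tr: "(transpose has_derivative transpose) (at A within SO)"
    by (rule bounded_linear_imp_has_derivative[OF bounded_linear_transpose])
  have br: "linear (\<lambda>S :: 'n mat. lie_bracket S B)"
    by (simp add: linear_iff lie_bracket_def matrix_distribs algebra_simps)
  have "((\<lambda>A. (A ** lie_bracket (Y A) B ** transpose A) $ p $ q) has_derivative
      (\<lambda>v. (A ** lie_bracket (Y A) B ** transpose v +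
         (A ** lie_bracket (?DY v) B + v ** lie_bracket (Y A) B) ** transpose A) $ p $ q)) (at A within SO)"
    by (intro linear_has_derivative[OF nth] has_derivative_matrix_mult tr has_derivative_ident
        linear_has_derivative[OF br] vector_field_derivative[OF Y A])
  from deriv_along_eq[where X = X and A = A and v = "deriv_along Y (\<lambda>A. (A ** B ** transpose A) $ p $ q)",
      OF this deriv_along_orbit[OF Y] A vector_field_in_so[OF X A]]
  show ?thesis
    using vector_field_in_so[OF X A]
    by (simp add: matrix_transpose_mul so_def lie_bracket_def lift_deriv_def matrix_distribs matrix_mul_assoc)
qed

text \<open>By the Jacobi identity, comparing derivatives of all orbit entries shows that the
  discrepancy \<open>?V\<close>, taken before projecting, commutes with \<open>B\<close>. Then
  \<open>phi\<close> fixes it, so its projection to \<mm> is zero.\<close>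

lemma vf_bracket_eq:
  assumes X: "vector_field X" and Y: "vector_field Y" and Z: "is_vf_bracket X Y Z" and A: "A \<in> (SO :: 'n mat set)"
  shows "Z A = lift_deriv X Y A - lift_deriv Y X A + proj (lie_bracket (X A) (Y A))"
proof -
  let ?V = "Z A - (lift_deriv X Y A - lift_deriv Y X A) - lie_bracket (X A) (Y A)"
  have Zv: "vector_field Z" using Z by (simp add: is_vf_bracket_def)
  have m: "Z A \<in> \<mm>" "lift_deriv X Y A \<in> \<mm>" "lift_deriv Y X A \<in> \<mm>"
    using X Y Zv A by (auto intro: vector_field_in_\<mm> lift_deriv_in_\<mm> vector_field_in_so)
  let ?R = "lie_bracket (X A) (lie_bracket (Y A) B) + lie_bracket (lift_deriv X Y A) B
      - (lie_bracket (Y A) (lie_bracket (X A) B) + lie_bracket (lift_deriv Y X A) B)"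
  have "(A ** lie_bracket (Z A) B ** transpose A) $ p $ q = (A ** ?R ** transpose A) $ p $ q" for p q
  proof -
    have "deriv_along Z (\<lambda>A. (A ** B ** transpose A) $ p $ q) A =
        deriv_along X (deriv_along Y (\<lambda>A. (A ** B ** transpose A) $ p $ q)) A
        - deriv_along Y (deriv_along X (\<lambda>A. (A ** B ** transpose A) $ p $ q)) A"
      using Z A smooth_function_orbit unfolding is_vf_bracket_def by blast
    then show ?thesis
      by (simp only: deriv_along_orbit[OF Zv A] deriv_along_deriv_along_orbit[OF X Y A]
          deriv_along_deriv_along_orbit[OF Y X A] matrix_diff_ldistrib matrix_diff_rdistrib vector_minus_component)
  qed
  then have "A ** lie_bracket (Z A) B ** transpose A = A ** ?R ** transpose A" by (simp add: vec_eq_iff)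
  then have "lie_bracket (Z A) B = ?R"
    by (metis SO_cancel(1)[OF A] matrix_mul_assoc matrix_mul_lid matrix_mul_rid)
  then have "lie_bracket ?V B = 0"
    using lie_bracket_jacobi[of "X A" "Y A" B] by (simp add: lie_bracket_diff_left)
  then have "B ** ?V ** transpose B = ?V ** (B ** transpose B)"
    by (simp add: lie_bracket_def matrix_mul_assoc)
  then have "phi ?V = ?V"
    using B_orthogonal by (simp add: phi_eq orthogonal_matrix_def)
  then have "proj ?V = 0" by (simp add: proj_def flip: scaleR_2) (simp add: vec_eq_iff)
  moreover have "proj ?V = Z A - (lift_deriv X Y A - lift_deriv Y X A) - proj (lie_bracket (X A) (Y A))"
    by (simp add: linear_diff[OF proj_linear] proj_\<mm> m)
  ultimately show ?thesis by (simp add: algebra_simps)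
qed

section \<open>Canonical f-structures acting on vector fields\<close>

lemma f_typeD:
  assumes "f_type e1 e2 f"
  shows "linear f" "x \<in> \<mm> \<Longrightarrow> f x \<in> \<mm>"
    "x \<in> \<mm> \<Longrightarrow> f x $ i1 $ i2 = e1 * x $ i1 $ i3" "x \<in> \<mm> \<Longrightarrow> f x $ i1 $ i3 = - e1 * x $ i1 $ i2"
    "x \<in> \<mm> \<Longrightarrow> j \<in> rest \<Longrightarrow> f x $ i1 $ j = 0"
    "x \<in> \<mm> \<Longrightarrow> j \<in> rest \<Longrightarrow> f x $ i2 $ j = - e2 * x $ i3 $ j"
    "x \<in> \<mm> \<Longrightarrow> j \<in> rest \<Longrightarrow> f x $ i3 $ j = e2 * x $ i2 $ j"
  using assms by (simp_all add: f_type_def)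

lemma vector_field_f:
  assumes f: "f_type e1 e2 f" and X: "vector_field X"
  shows "vector_field (f \<circ> X)"
  unfolding vector_field_def
proof (intro conjI ballI)
  show "smooth_on SO (f \<circ> X)"
    using f_typeD(1)[OF f] X
    by (intro smooth_on_bounded_linear) (simp_all add: linear_conv_bounded_linear vector_field_def)
  show "(f \<circ> X) A \<in> \<mm>" if "A \<in> SO" for A
    using f_typeD(2)[OF f] vector_field_in_\<mm>[OF X that] by simp
  fix A h :: "'n mat" assume "A \<in> SO" "h \<in> H"
  then have "X (A ** h) = transpose h ** X A ** transpose (transpose h)"
    using X by (simp add: vector_field_def matrix_inv_SO[OF H_SO])
  then show "(f \<circ> X) (A ** h) = matrix_inv h ** (f \<circ> X) A ** h"
    using f H_transpose_commute[OF \<open>h \<in> H\<close>]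
    by (simp add: f_type_def matrix_inv_SO[OF H_SO[OF \<open>h \<in> H\<close>]] del: transpose_transpose) simp
qed

text \<open>\<open>f\<close> is one fixed linear map at all points, so it commutes with
  differentiation of the lift.\<close>

lemma lift_deriv_f:
  assumes f: "f_type e1 e2 f" and X: "vector_field X" and Y: "vector_field Y" and A: "A \<in> SO"
  shows "lift_deriv X (f \<circ> Y) A = f (lift_deriv X Y A)"
  unfolding lift_deriv_def
  by (rule derivative_tangent_unique[OF vector_field_derivative[OF vector_field_f[OF f Y] A]
        linear_has_derivative[OF f_typeD(1)[OF f] vector_field_derivative[OF Y A]] _ A vector_field_in_so[OF X A]])
    simp

section \<open>The Levi-Civita connection\<close>

text \<open>The map \<open>\<Lambda>\<close>. On \<open>\<mm>\<close> the map \<open>weight s t\<close> is \<open>Q\<close> and \<open>weight (1 / s) (1 / t)\<close> its inverse; both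
  annihilate \<open>\<hh>\<close>.\<close>

definition nomizu :: "real \<Rightarrow> real \<Rightarrow> 'n mat \<Rightarrow> 'n mat \<Rightarrow> 'n mat" where
  "nomizu s t x y = (1 / 2) *\<^sub>R weight (1 / s) (1 / t)
     (weight s t (lie_bracket x y) + lie_bracket x (weight s t y) - lie_bracket (weight s t x) y)"

lemma nomizu_in_\<mm>: "x \<in> \<mm> \<Longrightarrow> y \<in> \<mm> \<Longrightarrow> nomizu s t x y \<in> \<mm>"
  unfolding nomizu_def
  by (intro subspace_scale[OF subspace_\<mm>] weight_in_\<mm> subspace_diff[OF subspace_so]
      subspace_add[OF subspace_so] lie_bracket_so \<mm>_imp_so) (auto intro: \<mm>_imp_so)

text \<open>After subtraction of the lift derivative, torsion-freeness and metric compatibility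
  become algebraic identities at the point \<open>A\<close>, and Koszul's argument solves
  them.\<close>

lemma levi_civita_eq:
  fixes nabla :: "'n connection"
  assumes LC: "levi_civita (inv_metric s t) nabla" and s: "s > 0" and t: "t > 0"
    and X: "vector_field X" and Y: "vector_field Y" and A: "A \<in> SO"
  shows "nabla X Y A = lift_deriv X Y A + nomizu s t (X A) (Y A)"
proof -
  define N where "N X Y = nabla X Y A - lift_deriv X Y A" for X Y
  have nab: "vector_field (nabla X Y)" if "vector_field X" "vector_field Y" for X Y
    using LC that by (simp add: levi_civita_def affine_connection_def)
  have N: "N X Y \<in> \<mm>" if "vector_field X" "vector_field Y" for X Y
    unfolding N_def using that
    by (intro subspace_diff[OF subspace_\<mm>] vector_field_in_\<mm> nab A lift_deriv_in_\<mm> vector_field_in_so)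
  have dim: "real CARD('n) - 2 \<noteq> 0" using card4 by simp
  have torsion: "N X Y - N Y X = proj (lie_bracket (X A) (Y A))"
    if "vector_field X" "vector_field Y" for X Y
  proof -
    have "is_vf_bracket X Y (\<lambda>A. nabla X Y A - nabla Y X A)"
      using LC that by (simp add: levi_civita_def)
    from vf_bracket_eq[OF that this A] show ?thesis
      by (simp add: N_def algebra_simps)
  qed
  have metric: "N X Y \<bullet> weight s t (Z A) + N X Z \<bullet> weight s t (Y A) = 0"
    if X: "vector_field X" and Y: "vector_field Y" and Z: "vector_field Z" for X Y Z
  proof -
    have so: "Y A \<in> so" "Z A \<in> so" "nabla X Y A \<in> so" "nabla X Z A \<in> so"
      "lift_deriv X Y A \<in> so" "lift_deriv X Z A \<in> so"
      using X Y Z A by (auto intro: vector_field_in_so nab \<mm>_imp_so lift_deriv_in_\<mm>)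
    have "((\<lambda>A. (real CARD('n) - 2) *\<^sub>R (Y A \<bullet> weight s t (Z A))) has_derivative
       (\<lambda>v. (real CARD('n) - 2) *\<^sub>R (Y A \<bullet> weight s t (frechet_derivative Z (at A within SO) v)
          + frechet_derivative Y (at A within SO) v \<bullet> weight s t (Z A)))) (at A within SO)"
      by (intro has_derivative_scaleR_right has_derivative_inner linear_has_derivative[OF weight_linear]
          vector_field_derivative Y Z A)
      from deriv_along_eq[where X = X and A = A and v = "\<lambda>A. inv_metric s t (Y A) (Z A)",
        OF this _ A vector_field_in_so[OF X A]]
    have "deriv_along X (\<lambda>A. inv_metric s t (Y A) (Z A)) A = (real CARD('n) - 2) *
        (Y A \<bullet> weight s t (lift_deriv X Z A) + lift_deriv X Y A \<bullet> weight s t (Z A))"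
      by (simp add: inv_metric_eq vector_field_in_so Y Z lift_deriv_def)
    moreover have "deriv_along X (\<lambda>A. inv_metric s t (Y A) (Z A)) A
       = inv_metric s t (nabla X Y A) (Z A) + inv_metric s t (Y A) (nabla X Z A)"
      using LC X Y Z A by (simp add: levi_civita_def)
    ultimately have "(real CARD('n) - 2) *
        (Y A \<bullet> weight s t (lift_deriv X Z A) + lift_deriv X Y A \<bullet> weight s t (Z A))
       = (real CARD('n) - 2) * (nabla X Y A \<bullet> weight s t (Z A) + Y A \<bullet> weight s t (nabla X Z A))"
      using so by (simp add: inv_metric_eq algebra_simps)
    then have "Y A \<bullet> weight s t (lift_deriv X Z A) + lift_deriv X Y A \<bullet> weight s t (Z A)
       = nabla X Y A \<bullet> weight s t (Z A) + Y A \<bullet> weight s t (nabla X Z A)"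
      using dim by simp
    moreover have "Y A \<bullet> weight s t S = S \<bullet> weight s t (Y A)" if "S \<in> so" for S
      using inner_weight_commute[OF so(1) that] by (simp add: inner_commute)
    ultimately show ?thesis
      using so by (simp add: N_def inner_diff_left)
  qed
  let ?x = "X A" and ?y = "Y A"
  let ?V = "weight s t (lie_bracket ?x ?y) + lie_bracket ?x (weight s t ?y) - lie_bracket (weight s t ?x) ?y"
  let ?n = "N X Y"
  have xy: "?x \<in> so" "?y \<in> so" using vector_field_in_so X Y A by auto
  have V: "?V \<in> so"
    by (intro subspace_diff[OF subspace_so] subspace_add[OF subspace_so] lie_bracket_so \<mm>_imp_so[OF weight_in_\<mm>] xy)
  have nso: "?n \<in> so" using N[OF X Y] \<mm>_imp_so by blast
  have pinner: "proj v \<bullet> z = v \<bullet> z" if "v \<in> so" "z \<in> \<mm>" for v z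
    using that proj_in_\<mm>[OF that(1)] by (simp add: inner_so_\<mm> \<mm>_imp_so proj_component)
  have koszul: "(2 *\<^sub>R weight s t ?n) \<bullet> z = ?V \<bullet> z" if z: "z \<in> \<mm>" for z
  proof -
    \<comment> \<open>The identities hold for fields, so the test vector is first extended to a
      field.\<close>
    obtain Z where Z: "vector_field Z" "Z A = z" using vector_field_at[OF A z] by blast
    have zso: "z \<in> so" using z by (rule \<mm>_imp_so)
    define b where "b x y z = lie_bracket x y \<bullet> weight s t z" for x y z
    have tor: "N X Y \<bullet> weight s t z' = N Y X \<bullet> weight s t z' + b (X A) (Y A) z'"
      if "vector_field X" "vector_field Y" "z' \<in> so" for X Y z'
    proof -
      have "(N X Y - N Y X) \<bullet> weight s t z' = lie_bracket (X A) (Y A) \<bullet> weight s t z'"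
        unfolding torsion[OF that(1,2)]
        by (intro pinner lie_bracket_so vector_field_in_so that A weight_in_\<mm>)
      then show ?thesis by (simp add: inner_diff_left b_def)
    qed
    \<comment> \<open>Three torsion and three metric identities, cyclic in the fields, form a linear
      system for six inner products; this is its solution for the first one.\<close>
    have "2 * (?n \<bullet> weight s t z) = b ?x ?y z - b ?y z ?x + b z ?x ?y"
      using tor[OF X Y zso] tor[OF Y Z(1) xy(1)] tor[OF Z(1) X xy(2)]
        metric[OF X Y Z(1)] metric[OF Y Z(1) X] metric[OF Z(1) X Y] Z(2) by simp
    also have "b ?x ?y z = weight s t (lie_bracket ?x ?y) \<bullet> z"
      unfolding b_def by (intro inner_weight_commute lie_bracket_so xy zso)
    also have "b ?y z ?x = lie_bracket (weight s t ?x) ?y \<bullet> z"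
      unfolding b_def using inner_lie_bracket[of "weight s t ?x" ?y z] xy
      by (simp add: inner_commute \<mm>_imp_so weight_in_\<mm>)
    also have "b z ?x ?y = lie_bracket ?x (weight s t ?y) \<bullet> z"
      unfolding b_def using inner_lie_bracket[OF zso xy(1), of "weight s t ?y"]
      by (simp add: inner_commute[of _ z])
    finally show ?thesis
      using inner_weight_commute[OF nso zso] by (simp add: inner_add_left inner_diff_left)
  qed
  have pV: "proj ?V \<in> \<mm>" using V by (rule proj_in_\<mm>)
  have w: "2 *\<^sub>R weight s t ?n \<in> \<mm>"
    by (intro subspace_scale[OF subspace_\<mm>] weight_in_\<mm> nso)
  \<comment> \<open>\<open>koszul\<close> is applied with the difference itself as test vector, so
    the difference has norm zero.\<close>
  have "(2 *\<^sub>R weight s t ?n - proj ?V) \<bullet> (2 *\<^sub>R weight s t ?n - proj ?V) = 0"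
    using koszul pinner[OF V] subspace_diff[OF subspace_\<mm> w pV] by (simp add: inner_diff_left)
  then have eq: "2 *\<^sub>R weight s t ?n = proj ?V" by simp
  have "?n = nomizu s t ?x ?y"
  proof (rule \<mm>_eqI[OF N[OF X Y] nomizu_in_\<mm>])
    show "?x \<in> \<mm>" "?y \<in> \<mm>" using X Y A by (auto intro: vector_field_in_\<mm>)
    \<comment> \<open>Reading off entries undoes the weights block by block, dividing by 1,
      \<open>s\<close> or \<open>t\<close>.\<close>
    have c: "2 * weight s t ?n $ p $ q = proj ?V $ p $ q" for p q
      using arg_cong[OF eq, of "\<lambda>S. S $ p $ q"] by simp
    show "?n $ i1 $ i2 = nomizu s t ?x ?y $ i1 $ i2" "?n $ i1 $ i3 = nomizu s t ?x ?y $ i1 $ i3"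
      using c[of i1 i2] c[of i1 i3] by (simp_all add: nomizu_def proj_component weight_component)
    fix j :: 'n assume j: "j \<in> rest"
    show "?n $ i1 $ j = nomizu s t ?x ?y $ i1 $ j" "?n $ i2 $ j = nomizu s t ?x ?y $ i2 $ j"
      "?n $ i3 $ j = nomizu s t ?x ?y $ i3 $ j"
      using c[of i1 j] c[of i2 j] c[of i3 j] j s t
      by (simp_all add: nomizu_def proj_component weight_component field_simps)
  qed
  then show ?thesis by (simp add: N_def algebra_simps)
qed

section \<open>Brackets and \<Lambda> in components\<close>

text \<open>Modulo \<hh>, the bracket of two different blocks lies in the third one, and a block
  bracketed with itself gives zero.\<close>

lemma bracket_component:
  fixes x y :: "'n mat"
  assumes "x \<in> \<mm>" "y \<in> \<mm>"
  shows "lie_bracket x y $ i1 $ i2 = (\<Sum>k\<in>rest. y $ i1 $ k * x $ i2 $ k - x $ i1 $ k * y $ i2 $ k)"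
    "lie_bracket x y $ i1 $ i3 = (\<Sum>k\<in>rest. y $ i1 $ k * x $ i3 $ k - x $ i1 $ k * y $ i3 $ k)"
    "j \<in> rest \<Longrightarrow> lie_bracket x y $ i1 $ j =
       x $ i1 $ i2 * y $ i2 $ j + x $ i1 $ i3 * y $ i3 $ j - (y $ i1 $ i2 * x $ i2 $ j + y $ i1 $ i3 * x $ i3 $ j)"
    "j \<in> rest \<Longrightarrow> lie_bracket x y $ i2 $ j = y $ i1 $ i2 * x $ i1 $ j - x $ i1 $ i2 * y $ i1 $ j"
    "j \<in> rest \<Longrightarrow> lie_bracket x y $ i3 $ j = y $ i1 $ i3 * x $ i1 $ j - x $ i1 $ i3 * y $ i1 $ j"
proof -
  have mult: "(u ** v) $ i1 $ i2 = - (\<Sum>k\<in>rest. u $ i1 $ k * v $ i2 $ k)"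
    "(u ** v) $ i1 $ i3 = - (\<Sum>k\<in>rest. u $ i1 $ k * v $ i3 $ k)"
    "j \<in> rest \<Longrightarrow> (u ** v) $ i1 $ j = u $ i1 $ i2 * v $ i2 $ j + u $ i1 $ i3 * v $ i3 $ j"
    "j \<in> rest \<Longrightarrow> (u ** v) $ i2 $ j = - (u $ i1 $ i2 * v $ i1 $ j)"
    "j \<in> rest \<Longrightarrow> (u ** v) $ i3 $ j = - (u $ i1 $ i3 * v $ i1 $ j)"
    if uv: "u \<in> \<mm>" "v \<in> \<mm>" for u v :: "'n mat" and j
  proof -
    have u: "u \<in> so" and v: "v \<in> so" using uv by (auto intro: \<mm>_imp_so)
    have 0: "u $ i2 $ i3 = 0" "u $ i3 $ i2 = 0" "v $ i2 $ i3 = 0" "v $ i3 $ i2 = 0"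
      "\<And>j k. j \<in> rest \<Longrightarrow> k \<in> rest \<Longrightarrow> v $ k $ j = 0"
      using uv so_component[OF u, of i2 i3] so_component[OF v, of i2 i3] by (auto simp: \<mm>_iff)
    have 1: "u $ i2 $ i1 = - u $ i1 $ i2" "u $ i3 $ i1 = - u $ i1 $ i3"
      by (rule so_component[OF u])+
    have "(\<Sum>k\<in>rest. u $ i1 $ k * v $ k $ q) = (\<Sum>k\<in>rest. - (u $ i1 $ k * v $ q $ k))" for q
    proof (intro sum.cong refl)
      show "u $ i1 $ k * v $ k $ q = - (u $ i1 $ k * v $ q $ k)" for k
        using so_component[OF v, of q k] by simp
    qed
    then show "(u ** v) $ i1 $ i2 = - (\<Sum>k\<in>rest. u $ i1 $ k * v $ i2 $ k)"
      "(u ** v) $ i1 $ i3 = - (\<Sum>k\<in>rest. u $ i1 $ k * v $ i3 $ k)"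
      using 0 so_diagonal[OF u] so_diagonal[OF v]
      by (simp_all add: matrix_matrix_mult_def sum_blocks sum_negf)
    show "j \<in> rest \<Longrightarrow> (u ** v) $ i1 $ j = u $ i1 $ i2 * v $ i2 $ j + u $ i1 $ i3 * v $ i3 $ j"
      "j \<in> rest \<Longrightarrow> (u ** v) $ i2 $ j = - (u $ i1 $ i2 * v $ i1 $ j)"
      "j \<in> rest \<Longrightarrow> (u ** v) $ i3 $ j = - (u $ i1 $ i3 * v $ i1 $ j)"
      using 1(1,2) 0 so_diagonal[OF u] by (simp_all add: matrix_matrix_mult_def sum_blocks)
  qed
  show "lie_bracket x y $ i1 $ i2 = (\<Sum>k\<in>rest. y $ i1 $ k * x $ i2 $ k - x $ i1 $ k * y $ i2 $ k)"
    "lie_bracket x y $ i1 $ i3 = (\<Sum>k\<in>rest. y $ i1 $ k * x $ i3 $ k - x $ i1 $ k * y $ i3 $ k)"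
    "j \<in> rest \<Longrightarrow> lie_bracket x y $ i1 $ j =
       x $ i1 $ i2 * y $ i2 $ j + x $ i1 $ i3 * y $ i3 $ j - (y $ i1 $ i2 * x $ i2 $ j + y $ i1 $ i3 * x $ i3 $ j)"
    "j \<in> rest \<Longrightarrow> lie_bracket x y $ i2 $ j = y $ i1 $ i2 * x $ i1 $ j - x $ i1 $ i2 * y $ i1 $ j"
    "j \<in> rest \<Longrightarrow> lie_bracket x y $ i3 $ j = y $ i1 $ i3 * x $ i1 $ j - x $ i1 $ i3 * y $ i1 $ j"
    using assms by (simp_all add: lie_bracket_def mult sum_subtractf)
qed

text \<open>With weights q = (1, s, t), for x in the i-th and y in the j-th block the k-th component
  of [x, y] is multiplied by (q_k + q_j - q_i) / (2 q_k).\<close>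

lemma nomizu_component:
  fixes x y :: "'n mat"
  assumes xy: "x \<in> \<mm>" "y \<in> \<mm>"
  shows "nomizu s t x y $ i1 $ i2 =
      (\<Sum>k\<in>rest. (1 + t - s) / 2 * (x $ i2 $ k * y $ i1 $ k) - (1 + s - t) / 2 * (x $ i1 $ k * y $ i2 $ k))"
    "nomizu s t x y $ i1 $ i3 =
      (\<Sum>k\<in>rest. (1 + t - s) / 2 * (x $ i3 $ k * y $ i1 $ k) - (1 + s - t) / 2 * (x $ i1 $ k * y $ i3 $ k))"
    "j \<in> rest \<Longrightarrow> nomizu s t x y $ i1 $ j = 1 / (2 * t) *
      ((t + s - 1) * (x $ i1 $ i2 * y $ i2 $ j + x $ i1 $ i3 * y $ i3 $ j)
        - (t + 1 - s) * (y $ i1 $ i2 * x $ i2 $ j + y $ i1 $ i3 * x $ i3 $ j))"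
    "j \<in> rest \<Longrightarrow> nomizu s t x y $ i2 $ j = 1 / (2 * s) *
      ((s + 1 - t) * (y $ i1 $ i2 * x $ i1 $ j) - (s + t - 1) * (x $ i1 $ i2 * y $ i1 $ j))"
    "j \<in> rest \<Longrightarrow> nomizu s t x y $ i3 $ j = 1 / (2 * s) *
      ((s + 1 - t) * (y $ i1 $ i3 * x $ i1 $ j) - (s + t - 1) * (x $ i1 $ i3 * y $ i1 $ j))"
proof -
  have w: "weight s t x \<in> \<mm>" "weight s t y \<in> \<mm>" using xy by (auto intro: weight_in_\<mm> \<mm>_imp_so)
  note comps = nomizu_def weight_component bracket_component[OF xy] bracket_component[OF xy(1) w(2)]
    bracket_component[OF w(1) xy(2)]
  show "nomizu s t x y $ i1 $ i2 =
      (\<Sum>k\<in>rest. (1 + t - s) / 2 * (x $ i2 $ k * y $ i1 $ k) - (1 + s - t) / 2 * (x $ i1 $ k * y $ i2 $ k))"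
    "nomizu s t x y $ i1 $ i3 =
      (\<Sum>k\<in>rest. (1 + t - s) / 2 * (x $ i3 $ k * y $ i1 $ k) - (1 + s - t) / 2 * (x $ i1 $ k * y $ i3 $ k))"
    by (simp_all add: comps sum_divide_distrib flip: sum.distrib sum_subtractf)
      (auto intro!: sum.cong simp: weight_component field_simps)
  show "j \<in> rest \<Longrightarrow> nomizu s t x y $ i1 $ j = 1 / (2 * t) *
      ((t + s - 1) * (x $ i1 $ i2 * y $ i2 $ j + x $ i1 $ i3 * y $ i3 $ j)
        - (t + 1 - s) * (y $ i1 $ i2 * x $ i2 $ j + y $ i1 $ i3 * x $ i3 $ j))"
    "j \<in> rest \<Longrightarrow> nomizu s t x y $ i2 $ j = 1 / (2 * s) *
      ((s + 1 - t) * (y $ i1 $ i2 * x $ i1 $ j) - (s + t - 1) * (x $ i1 $ i2 * y $ i1 $ j))"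
    "j \<in> rest \<Longrightarrow> nomizu s t x y $ i3 $ j = 1 / (2 * s) *
      ((s + 1 - t) * (y $ i1 $ i3 * x $ i1 $ j) - (s + t - 1) * (x $ i1 $ i3 * y $ i1 $ j))"
    by (simp_all add: comps algebra_simps)
qed

section \<open>Killing, nearly Kaehler and G1 f-structures\<close>

text \<open>The value of \<open>(\<nabla>\<^sub>X f) X\<close> at a point where \<open>X\<close> is \<open>x\<close>.\<close>

definition defect :: "real \<Rightarrow> real \<Rightarrow> ('n mat \<Rightarrow> 'n mat) \<Rightarrow> 'n mat \<Rightarrow> 'n mat" where
  "defect s t f x = nomizu s t x (f x) - f (nomizu s t x x)"

text \<open>The vectors enter through products of entries from two different blocks; the
  coefficients decide all three properties.\<close>

lemma defect_component:
  assumes f: "f_type e1 e2 f" and x: "x \<in> \<mm>" and s: "s > 0"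
  shows "defect s t f x $ i1 $ i2 = (e2 * (1 + s - t) / 2 + e1 * (s - t)) * (\<Sum>k\<in>rest. x $ i1 $ k * x $ i3 $ k)"
    "defect s t f x $ i1 $ i3 = - (e2 * (1 + s - t) / 2 + e1 * (s - t)) * (\<Sum>k\<in>rest. x $ i1 $ k * x $ i2 $ k)"
    "j \<in> rest \<Longrightarrow> defect s t f x $ i1 $ j =
      (e2 * (t + s - 1) - e1 * (t + 1 - s)) / (2 * t) * (x $ i1 $ i3 * x $ i2 $ j - x $ i1 $ i2 * x $ i3 $ j)"
    "j \<in> rest \<Longrightarrow> defect s t f x $ i2 $ j = (e1 * (s + 1 - t) / 2 + e2 * (1 - t)) / s * (x $ i1 $ i3 * x $ i1 $ j)"
    "j \<in> rest \<Longrightarrow> defect s t f x $ i3 $ j = - ((e1 * (s + 1 - t) / 2 + e2 * (1 - t)) / s * (x $ i1 $ i2 * x $ i1 $ j))"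
proof -
  have fx: "f x \<in> \<mm>" and nx: "nomizu s t x x \<in> \<mm>" using f_typeD(2)[OF f] x by (auto intro: nomizu_in_\<mm>)
  note comps = defect_def f_typeD(3-)[OF f nx] f_typeD(3-)[OF f x] nomizu_component[OF x fx] nomizu_component[OF x x]
  show "defect s t f x $ i1 $ i2 = (e2 * (1 + s - t) / 2 + e1 * (s - t)) * (\<Sum>k\<in>rest. x $ i1 $ k * x $ i3 $ k)"
    by (simp add: comps sum_distrib_left flip: sum_subtractf) (auto intro!: sum.cong simp: f_typeD(3-)[OF f x] field_simps)
  show "defect s t f x $ i1 $ i3 = - (e2 * (1 + s - t) / 2 + e1 * (s - t)) * (\<Sum>k\<in>rest. x $ i1 $ k * x $ i2 $ k)"
    by (simp add: comps sum_distrib_left flip: sum_subtractf sum.distrib) (auto intro!: sum.cong simp: f_typeD(3-)[OF f x] field_simps)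
  show "j \<in> rest \<Longrightarrow> defect s t f x $ i1 $ j =
      (e2 * (t + s - 1) - e1 * (t + 1 - s)) / (2 * t) * (x $ i1 $ i3 * x $ i2 $ j - x $ i1 $ i2 * x $ i3 $ j)"
    by (simp add: comps divide_simps) (simp add: algebra_simps)
  show
    "j \<in> rest \<Longrightarrow> defect s t f x $ i2 $ j = (e1 * (s + 1 - t) / 2 + e2 * (1 - t)) / s * (x $ i1 $ i3 * x $ i1 $ j)"
    "j \<in> rest \<Longrightarrow> defect s t f x $ i3 $ j = - ((e1 * (s + 1 - t) / 2 + e2 * (1 - t)) / s * (x $ i1 $ i2 * x $ i1 $ j))"
    using s by (simp_all add: comps field_simps)
qed

lemma defect_in_\<mm>:
  assumes f: "f_type e1 e2 f" and x: "x \<in> \<mm>"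
  shows "defect s t f x \<in> \<mm>"
  unfolding defect_def
  by (intro subspace_diff[OF subspace_\<mm>] nomizu_in_\<mm> f_typeD(2)[OF f] x)

text \<open>By \<open>lift_deriv_f\<close> the two lift derivative terms cancel, and only \<Lambda>
  remains.\<close>

lemma nabla_f_eq:
  assumes LC: "levi_civita (inv_metric s t) nabla" and st: "s > 0" "t > 0"
    and f: "f_type e1 e2 f" and X: "vector_field X" and A: "A \<in> SO"
  shows "nabla_f nabla f X X A = defect s t f (X A)"
  using levi_civita_eq[OF LC st X X A] levi_civita_eq[OF LC st X vector_field_f[OF f X] A]
    lift_deriv_f[OF f X X A] linear_add[OF f_typeD(1)[OF f]]
  by (simp add: nabla_f_def defect_def)

section \<open>The f-structure and metric conditions\<close>

text \<open>Each J_i squares to -1 on its block, so the cube of \<open>f\<close> is -(e1^3 J_1 +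
  e2^3 J_2), which is \<open>- f\<close> when both coefficients equal their cubes.\<close>

lemma f_structure_f_type:
  assumes f: "f_type e1 e2 f" and e: "e1 ^ 3 = e1" "e2 ^ 3 = e2"
  shows "f_structure f"
  unfolding f_structure_def
proof (intro conjI ballI allI)
  show "f x \<in> \<mm>" if "x \<in> \<mm>" for x using that by (rule f_typeD(2)[OF f])
  show "f (x + y) = f x + f y" "f (c *\<^sub>R x) = c *\<^sub>R f x" for x y c
    by (simp_all add: linear_add[OF f_typeD(1)[OF f]] linear_scale[OF f_typeD(1)[OF f]])
  show "f (h ** x ** matrix_inv h) = h ** f x ** matrix_inv h" if "h \<in> H" for h x
    using f H_commute[OF that] H_SO[OF that]
    by (simp add: f_type_def matrix_inv_SO) (simp add: SO_def)
  fix x :: "'n mat" assume x: "x \<in> \<mm>"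
  note m = f_typeD(2)[OF f x] f_typeD(2)[OF f f_typeD(2)[OF f x]]
    f_typeD(2)[OF f f_typeD(2)[OF f f_typeD(2)[OF f x]]]
  have e': "e1 * (e1 * e1) = e1" "e2 * (e2 * e2) = e2" using e by (simp_all add: power3_eq_cube mult.assoc)
  have cancel: "e1 * (e1 * (e1 * a)) = e1 * a" "e2 * (e2 * (e2 * a)) = e2 * a" for a
    using arg_cong[OF e'(1), of "\<lambda>e. e * a"] arg_cong[OF e'(2), of "\<lambda>e. e * a"] by (simp_all add: mult.assoc)
  show "f (f (f x)) + f x = 0"
    by (rule \<mm>_eqI) (use x m in \<open>auto simp: f_typeD(3-)[OF f] cancel intro: subspace_add[OF subspace_\<mm>] subspace_0[OF subspace_\<mm>]\<close>)
qed

text \<open>J_1 and J_2 are skew for the trace form and the weights are constant on each block, so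
  \<open>f\<close> is skew for every \<open>s\<close> and \<open>t\<close>.\<close>

lemma metric_f_structure_f_type:
  assumes f: "f_type e1 e2 f" and e: "e1 ^ 3 = e1" "e2 ^ 3 = e2"
  shows "metric_f_structure (inv_metric s t) f"
  unfolding metric_f_structure_def
proof (intro conjI allI ballI impI)
  show "f_structure f" by (rule f_structure_f_type[OF assms])
  fix X Y :: "'n mat \<Rightarrow> 'n mat" and A :: "'n mat"
  assume XY: "vector_field X \<and> vector_field Y" and A: "A \<in> SO"
  let ?x = "X A" and ?y = "Y A"
  have m: "?x \<in> \<mm>" "?y \<in> \<mm>" "f ?x \<in> \<mm>" "f ?y \<in> \<mm>"
    using XY A by (auto intro: vector_field_in_\<mm> f_typeD(2)[OF f])
  then have "f ?x \<bullet> weight s t ?y + ?x \<bullet> weight s t (f ?y) = 0"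
    by (simp add: inner_so_\<mm> \<mm>_imp_so weight_in_\<mm> weight_component f_typeD(3-)[OF f m(1)] f_typeD(3-)[OF f m(2)]
        algebra_simps sum_subtractf sum.distrib)
  then show "inv_metric s t (f ?x) ?y + inv_metric s t ?x (f ?y) = 0"
    using m by (simp add: inv_metric_eq \<mm>_imp_so flip: distrib_left)
qed

lemma skew_in_\<mm>:
  "j \<in> (rest :: 'n set) \<Longrightarrow> skew i1 j \<in> \<mm>" "j \<in> (rest :: 'n set) \<Longrightarrow> skew i2 j \<in> \<mm>"
  "j \<in> (rest :: 'n set) \<Longrightarrow> skew i3 j \<in> \<mm>" "skew i1 (i3 :: 'n) \<in> \<mm>"
  unfolding \<mm>_iff by (auto intro!: skew_in_so) (auto simp: skew_def)

text \<open>All quadratic expressions that are tested in \<open>defect_component\<close> take the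
  value 1 here; the last condition reduces the sum over \<open>rest\<close> to the single index
  \<open>j\<close>.\<close>

lemma generic_vector:
  obtains x :: "'n mat" and j where "x \<in> \<mm>" "j \<in> rest" "x $ i1 $ i2 = 0" "x $ i1 $ i3 = 1"
    "x $ i1 $ j = 1" "x $ i2 $ j = 1" "x $ i3 $ j = 1"
    "\<forall>k\<in>rest. k \<noteq> j \<longrightarrow> x $ i1 $ k = 0"
proof -
  obtain j :: 'n where j: "j \<in> rest" using rest_nonempty by blast
  let ?x = "skew i1 i3 + skew i1 j + skew i2 j + skew i3 j :: 'n mat"
  have "?x \<in> \<mm>"
    by (intro subspace_add[OF subspace_\<mm>] skew_in_\<mm> j)
  then show ?thesis
    by (rule that[OF _ j]) (use j in \<open>auto simp: skew_def\<close>)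
qed

section \<open>Criteria in terms of s, t, e1, e2\<close>

text \<open>Necessity comes from a field with the generic value at the identity matrix; sufficiency
  holds because every component of the defect carries one of the three coefficients as a
  factor.\<close>

lemma killing_f_iff:
  assumes LC: "levi_civita (inv_metric s t) nabla" and s: "s > 0" and t: "t > 0"
    and f: "f_type e1 e2 f" and e: "e1 ^ 3 = e1" "e2 ^ 3 = e2"
  shows "killing_f_structure (inv_metric s t) nabla f \<longleftrightarrow>
    e2 * (1 + s - t) / 2 + e1 * (s - t) = 0 \<and> e1 * (s + 1 - t) / 2 + e2 * (1 - t) = 0
    \<and> e2 * (t + s - 1) - e1 * (t + 1 - s) = 0" (is "_ \<longleftrightarrow> ?k1 = 0 \<and> ?k2 = 0 \<and> ?k3 = 0")
proof
  assume K: "killing_f_structure (inv_metric s t) nabla f"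
  obtain x :: "'n mat" and j where x: "x \<in> \<mm>" "j \<in> rest" "x $ i1 $ i2 = 0" "x $ i1 $ i3 = 1"
    "x $ i1 $ j = 1" "x $ i2 $ j = 1" "x $ i3 $ j = 1" "\<forall>k\<in>rest. k \<noteq> j \<longrightarrow> x $ i1 $ k = 0"
    by (rule generic_vector)
  have one: "(mat 1 :: 'n mat) \<in> SO" by (simp add: SO_def orthogonal_matrix_id)
  then obtain X where X: "vector_field X" "X (mat 1) = x" using vector_field_at x(1) by blast
  have D: "defect s t f x = 0"
    using K X one nabla_f_eq[OF LC s t f X(1) one] by (simp add: killing_f_structure_def)
  have "(\<Sum>k\<in>rest. x $ i1 $ k * x $ i3 $ k) = (\<Sum>k\<in>rest. if k = j then 1 else 0)"
    using x by (intro sum.cong) auto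
  also have "\<dots> = 1" using x(2) by simp
  finally have "?k1 = 0" using defect_component(1)[OF f x(1) s, of t] D by simp
  moreover have "?k2 = 0" using defect_component(4)[OF f x(1) s x(2), of t] D x s by simp
  moreover have "?k3 = 0" using defect_component(3)[OF f x(1) s x(2), of t] D x t by simp
  ultimately show "?k1 = 0 \<and> ?k2 = 0 \<and> ?k3 = 0" by blast
next
  assume k: "?k1 = 0 \<and> ?k2 = 0 \<and> ?k3 = 0"
  have "nabla_f nabla f X X A = 0" if "vector_field X" "A \<in> SO" for X A
  proof -
    have x: "X A \<in> \<mm>" using that by (rule vector_field_in_\<mm>)
    have "defect s t f (X A) = 0"
      by (rule \<mm>_eqI[OF defect_in_\<mm>[OF f x] subspace_0[OF subspace_\<mm>]])
        (simp_all only: defect_component[OF f x s] k, simp_all)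
    then show ?thesis by (simp add: nabla_f_eq[OF LC s t f that])
  qed
  then show "killing_f_structure (inv_metric s t) nabla f"
    by (simp add: killing_f_structure_def metric_f_structure_f_type[OF f e])
qed

text \<open>Without an \<mm>3-part in \<open>x\<close>, only the \<mm>3-part of the defect can
  survive, and \<open>f\<close> annihilates it. Vectors in the image of \<open>f\<close> are of this
  kind.\<close>

lemma defect_horizontal:
  assumes f: "f_type e1 e2 f" and x: "x \<in> \<mm>" and s: "s > 0"
    and 0: "\<And>j. j \<in> rest \<Longrightarrow> x $ i1 $ j = 0"
  shows "f (defect s t f x) = 0"
    and "e2 * (t + s - 1) - e1 * (t + 1 - s) = 0 \<or> (\<forall>j\<in>rest. x $ i1 $ i3 * x $ i2 $ j - x $ i1 $ i2 * x $ i3 $ j = 0)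
      \<Longrightarrow> defect s t f x = 0"
proof -
  have d: "defect s t f x \<in> \<mm>" by (rule defect_in_\<mm>[OF f x])
  have c: "defect s t f x $ i1 $ i2 = 0" "defect s t f x $ i1 $ i3 = 0"
    "\<And>j. j \<in> rest \<Longrightarrow> defect s t f x $ i2 $ j = 0" "\<And>j. j \<in> rest \<Longrightarrow> defect s t f x $ i3 $ j = 0"
    by (simp_all add: defect_component[OF f x s] 0)
  show "f (defect s t f x) = 0"
    by (rule \<mm>_eqI[OF f_typeD(2)[OF f d] subspace_0[OF subspace_\<mm>]]) (simp_all add: f_typeD(3-)[OF f d] c)
  show "defect s t f x = 0"
    if "e2 * (t + s - 1) - e1 * (t + 1 - s) = 0 \<or> (\<forall>j\<in>rest. x $ i1 $ i3 * x $ i2 $ j - x $ i1 $ i2 * x $ i3 $ j = 0)"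
  proof (rule \<mm>_eqI[OF d subspace_0[OF subspace_\<mm>]])
    show "defect s t f x $ i1 $ j = 0 $ i1 $ j" if "j \<in> rest" for j
      using \<open>_ \<or> _\<close> that by (auto simp only: defect_component[OF f x s] zero_index mult_zero_right mult_zero_left div_0)
  qed (simp_all add: c)
qed

text \<open>Replacing \<open>x\<close> by \<open>f x\<close> multiplies the quadratic expression in
  the \<mm>3-component by \<open>- e1 * e2\<close>; hence the two degenerate cases beside the
  vanishing coefficient.\<close>

lemma NKf_iff:
  assumes LC: "levi_civita (inv_metric s t) nabla" and s: "s > 0" and t: "t > 0"
    and f: "f_type e1 e2 f" and e: "e1 ^ 3 = e1" "e2 ^ 3 = e2"
  shows "NKf_structure (inv_metric s t) nabla f \<longleftrightarrow>
    e1 = 0 \<or> e2 = 0 \<or> e2 * (t + s - 1) - e1 * (t + 1 - s) = 0" (is "_ \<longleftrightarrow> e1 = 0 \<or> e2 = 0 \<or> ?k3 = 0")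
proof
  assume K: "NKf_structure (inv_metric s t) nabla f"
  obtain x :: "'n mat" and j where x: "x \<in> \<mm>" "j \<in> rest" "x $ i1 $ i2 = 0" "x $ i1 $ i3 = 1"
    "x $ i1 $ j = 1" "x $ i2 $ j = 1" "x $ i3 $ j = 1" "\<forall>k\<in>rest. k \<noteq> j \<longrightarrow> x $ i1 $ k = 0"
    by (rule generic_vector)
  have one: "(mat 1 :: 'n mat) \<in> SO" by (simp add: SO_def orthogonal_matrix_id)
  then obtain X where X: "vector_field X" "X (mat 1) = x" using vector_field_at x(1) by blast
  have D: "defect s t f (f x) = 0"
    using K X one nabla_f_eq[OF LC s t f vector_field_f[OF f X(1)] one] by (simp add: NKf_structure_def)
  show "e1 = 0 \<or> e2 = 0 \<or> ?k3 = 0"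
    using defect_component(3)[OF f f_typeD(2)[OF f x(1)] s x(2), of t] D x t
    by (auto simp: f_typeD(3-)[OF f x(1)])
next
  assume k: "e1 = 0 \<or> e2 = 0 \<or> ?k3 = 0"
  have "nabla_f nabla f (f \<circ> X) (f \<circ> X) A = 0" if "vector_field X" "A \<in> SO" for X A
  proof -
    have x: "X A \<in> \<mm>" using that by (rule vector_field_in_\<mm>)
    have "defect s t f (f (X A)) = 0"
      by (rule defect_horizontal(2)[OF f f_typeD(2)[OF f x] s]) (use k in \<open>auto simp: f_typeD(3-)[OF f x]\<close>)
    then show ?thesis by (simp add: nabla_f_eq[OF LC s t f vector_field_f[OF f that(1)] that(2)])
  qed
  then show "NKf_structure (inv_metric s t) nabla f"
    by (simp add: NKf_structure_def metric_f_structure_f_type[OF f e])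
qed

text \<open>Both terms of the tensor are \<open>f\<close> applied to the defect of a vector in the
  image of \<open>f\<close>, so each vanishes separately.\<close>

lemma G1f_structure_f_type:
  assumes LC: "levi_civita (inv_metric s t) nabla" and s: "s > 0" and t: "t > 0"
    and f: "f_type e1 e2 f" and e: "e1 ^ 3 = e1" "e2 ^ 3 = e2"
  shows "G1f_structure (inv_metric s t) nabla f"
proof -
  have "tensor_T nabla f X X A = 0" if X: "vector_field X" and A: "A \<in> SO" for X A
  proof -
    have x: "X A \<in> \<mm>" "f (X A) \<in> \<mm>" "f (f (X A)) \<in> \<mm>"
      using X A by (auto intro: vector_field_in_\<mm> f_typeD(2)[OF f])
    have "f (defect s t f (f (X A))) = 0" "f (defect s t f (f (f (X A)))) = 0"
      by (auto intro!: defect_horizontal(1)[OF f _ s] x simp: f_typeD(5)[OF f] x)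
    moreover have "vector_field (f \<circ> f \<circ> X)"
      using vector_field_f[OF f vector_field_f[OF f X]] by (simp add: comp_assoc)
    ultimately show ?thesis
      by (simp add: tensor_T_def nabla_f_eq[OF LC s t f _ A] vector_field_f[OF f X] linear_diff[OF f_typeD(1)[OF f]])
  qed
  then show ?thesis
    by (simp add: G1f_structure_def metric_f_structure_f_type[OF f e])
qed

end

theorem theorem3:
  fixes s t :: real and nabla :: "'n::finite connection"
  assumes n: "CARD('n) \<ge> 4"
    and s: "s > 0" and t: "t > 0"
    and LC: "levi_civita (inv_metric s t) nabla"
  shows
    "((killing_f_structure (inv_metric s t) nabla canon_f1 \<longleftrightarrow> s = 1 \<and> t = 4 / 3)
      \<and> \<not> killing_f_structure (inv_metric s t) nabla canon_f2
      \<and> \<not> killing_f_structure (inv_metric s t) nabla canon_f3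
      \<and> \<not> killing_f_structure (inv_metric s t) nabla canon_f4)
    \<and> ((NKf_structure (inv_metric s t) nabla canon_f1 \<longleftrightarrow> s = 1)
      \<and> NKf_structure (inv_metric s t) nabla canon_f2
      \<and> NKf_structure (inv_metric s t) nabla canon_f3
      \<and> \<not> NKf_structure (inv_metric s t) nabla canon_f4)
    \<and> (G1f_structure (inv_metric s t) nabla canon_f1
      \<and> G1f_structure (inv_metric s t) nabla canon_f2
      \<and> G1f_structure (inv_metric s t) nabla canon_f3
      \<and> G1f_structure (inv_metric s t) nabla canon_f4)"
proof -
  interpret matrix_blocks "TYPE('n)"
    by unfold_locales (rule n)
  note K = killing_f_iff[OF LC s t] and NK = NKf_iff[OF LC s t] and G = G1f_structure_f_type[OF LC s t]
  \<comment> \<open>For e1 = e2 = 1 the third condition is 2(s - 1) = 0; with s = 1 both others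
    become 2 - 3t/2 = 0.\<close>
  have "killing_f_structure (inv_metric s t) nabla canon_f1 \<longleftrightarrow> s = 1 \<and> t = 4 / 3"
    by (subst K[OF f_type_canon(1)]) (auto simp: field_simps)
  \<comment> \<open>The conditions 1 - t = 0 and 1 + s - t = 0 would give s = 0.\<close>
  moreover have "\<not> killing_f_structure (inv_metric s t) nabla canon_f2"
    using s by (subst K[OF f_type_canon(2)]) auto
  \<comment> \<open>The conditions s - t = 0 and s + 1 - t = 0 contradict each other.\<close>
  moreover have "\<not> killing_f_structure (inv_metric s t) nabla canon_f3"
    by (subst K[OF f_type_canon(3)]) auto
  \<comment> \<open>For e1 = 1, e2 = -1 the third expression is -2t, which is nonzero; the same
    value rules out the nearly Kaehler property below.\<close>
  moreover have "\<not> killing_f_structure (inv_metric s t) nabla canon_f4"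
    using t by (subst K[OF f_type_canon(4)]) auto
  moreover have "NKf_structure (inv_metric s t) nabla canon_f1 \<longleftrightarrow> s = 1"
    by (subst NK[OF f_type_canon(1)]) auto
  moreover have "NKf_structure (inv_metric s t) nabla canon_f2"
    by (subst NK[OF f_type_canon(2)]) auto
  moreover have "NKf_structure (inv_metric s t) nabla canon_f3"
    by (subst NK[OF f_type_canon(3)]) auto
  moreover have "\<not> NKf_structure (inv_metric s t) nabla canon_f4"
    using t by (subst NK[OF f_type_canon(4)]) auto
  ultimately show ?thesis
    using G[OF f_type_canon(1)] G[OF f_type_canon(2)] G[OF f_type_canon(3)] G[OF f_type_canon(4)] by simp
qed

end
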